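(* Let $\Gamma$ be a limit cycle of $\dot u=F(u)$ at a cusp of cycles (CPC) bifurcation, and let the critical center manifold near $\Gamma$ be parametrized by $(\tau,\xi)$ as in the context, so that the restricted dynamics has the CPC periodic normal form with cubic coefficient $c$. Let $v,\varphi^*,v^*$ be the functions defined in the context. Then for every real number $\alpha_1$ the boundary value problem $$\dot h_2-A(\tau)h_2-B(\tau;v,v)-2A(\tau)v-2F(u_0)+2\alpha_1F(u_0)=0\ (\tau\in[0,T]),\quad h_2(T)-h_2(0)=0,\quad \int_0^T\langle v^*,h_2\rangle\,d\tau=0$$ has a unique solution $h_2$, and $$c=\frac16\int_0^T\langle\varphi^*,\,-6\alpha_1A(\tau)v+3A(\tau)h_2+3B(\tau;v,v)+6A(\tau)v+3B(\tau;h_2,v)+C(\tau;v,v,v)\rangle\,d\tau .$$ The value of the right-hand side does not depend on the choice of $\alpha_1$ (in particular one may take $\alpha_1=0$).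
   Context: Setting. $F:\mathbb R^n\to\mathbb R^n$ is sufficiently smooth and $u_0$ is a nonconstant periodic solution of $\dot u=F(u)$ with minimal period $T>0$; $\Gamma$ is its orbit. Write $F(u_0(\tau)+w)=F(u_0)+A(\tau)w+\frac12B(\tau;w,w)+\frac1{3!}C(\tau;w,w,w)+\dots$, where $A(\tau)=F_u(u_0(\tau))$ and $B(\tau;\cdot,\cdot)$, $C(\tau;\cdot,\cdot,\cdot)$ are the symmetric multilinear forms of second and third derivatives of $F$ at $u_0(\tau)$. Dots over functions of $\tau$ denote $d/d\tau$; $\langle a,b\rangle=a^{\rm T}b$. Let $Y$ solve $\dot Y=A(\tau)Y$, $Y(0)=I_n$; the eigenvalues of $Y(T)$ are the multipliers, and a multiplier is critical if it has modulus 1. CPC bifurcation: the multiplier $1$ has a two-dimensional Jordan block (algebraic multiplicity 2), there are no other critical multipliers, and the quadratic coefficient of the normal form vanishes, so that the following holds. The two-dimensional critical center manifold near $\Gamma$ is parametrized as $u(\tau,\xi)=u_0(\tau)+\xi v(\tau)+H(\tau,\xi)$, $\xi\in\mathbb R$ small, with $H$ smooth and $T$-periodic in $\tau$, $H=\frac12h_2\xi^2+\frac16h_3\xi^3+O(\xi^4)$, where the part of $h_2$ along $F(u_0)$ is fixed by $\int_0^T\langle v^*,h_2\rangle d\tau=0$. The dynamics restricted to it is $$\frac{d\tau}{dt}=1-\xi+\alpha_1\xi^2+\alpha_2\xi^3+\dots,\qquad \frac{d\xi}{dt}=c\,\xi^3+\dots,$$ with real $\alpha_1,\alpha_2,c$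 and dots denoting $O(\xi^4)$ terms that are $T$-periodic in $\tau$; that is, if $(\tau(t),\xi(t))$ solves this system then $u(\tau(t),\xi(t))$ solves $\dot u=F(u)$. Here $v$ is the solution of $\dot v-A(\tau)v-F(u_0)=0$ on $[0,T]$, $v(T)=v(0)$, $\int_0^T\langle v,F(u_0)\rangle d\tau=0$; $\varphi^*$ is the solution of $\dot\varphi^*+A^{\rm T}(\tau)\varphi^*=0$, $\varphi^*(T)=\varphi^*(0)$, $\int_0^T\langle\varphi^*,v\rangle d\tau=1$; $v^*$ is the solution of $\dot v^*+A^{\rm T}(\tau)v^*+\varphi^*=0$, $v^*(T)=v^*(0)$, $\int_0^T\langle v^*,v\rangle d\tau=0$. *)

theory Defs
  imports
    "HOL-Analysis.Analysis"
    "HOL-Library.Landau_Symbols"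
    "HOL-Computational_Algebra.Polynomial"
begin

(* Class C^k on an open subset of a Euclidean space: all iterated directional derivatives
   up to order k exist (as Frechet derivatives) and are continuous. *)
fun Ck_on ::
  "nat \<Rightarrow> 'a::real_normed_vector set \<Rightarrow> ('a \<Rightarrow> 'b::real_normed_vector) \<Rightarrow> bool" where
  "Ck_on 0 S f \<longleftrightarrow> continuous_on S f"
| "Ck_on (Suc k) S f \<longleftrightarrow>
     (\<forall>x\<in>S. f differentiable (at x)) \<and>
     (\<forall>w. Ck_on k S (\<lambda>x. frechet_derivative f (at x) w))"

definition D1 :: "('a::real_normed_vector \<Rightarrow> 'b::real_normed_vector) \<Rightarrow> 'a \<Rightarrow> 'a \<Rightarrow> 'b" where
  "D1 F x w = frechet_derivative F (at x) w"

definition D2 :: "('a::real_normed_vector \<Rightarrow> 'b::real_normed_vector) \<Rightarrow> 'a \<Rightarrow> 'a \<Rightarrow> 'a \<Rightarrow> 'b" where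
  "D2 F x w1 w2 = frechet_derivative (\<lambda>y. D1 F y w1) (at x) w2"

definition D3 ::
  "('a::real_normed_vector \<Rightarrow> 'b::real_normed_vector) \<Rightarrow> 'a \<Rightarrow> 'a \<Rightarrow> 'a \<Rightarrow> 'a \<Rightarrow> 'b" where
  "D3 F x w1 w2 w3 = frechet_derivative (\<lambda>y. D2 F y w1 w2) (at x) w3"

definition limit_cycle :: "(real^'n \<Rightarrow> real^'n) \<Rightarrow> (real \<Rightarrow> real^'n) \<Rightarrow> real \<Rightarrow> bool" where
  "limit_cycle F u0 T \<longleftrightarrow>
     (\<forall>t. (u0 has_vector_derivative F (u0 t)) (at t)) \<and>
     (\<exists>s t. u0 s \<noteq> u0 t) \<and>
     0 < T \<and> (\<forall>t. u0 (t + T) = u0 t) \<and>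
     (\<forall>S. 0 < S \<and> S < T \<longrightarrow> (\<exists>t. u0 (t + S) \<noteq> u0 t))"

definition Amat :: "(real^'n \<Rightarrow> real^'n) \<Rightarrow> (real \<Rightarrow> real^'n) \<Rightarrow> real \<Rightarrow> real^'n^'n" where
  "Amat F u0 \<tau> = jacobian F (at (u0 \<tau>))"

definition Bform ::
  "(real^'n \<Rightarrow> real^'n) \<Rightarrow> (real \<Rightarrow> real^'n) \<Rightarrow> real \<Rightarrow> real^'n \<Rightarrow> real^'n \<Rightarrow> real^'n" where
  "Bform F u0 \<tau> w1 w2 = D2 F (u0 \<tau>) w1 w2"

definition Cform ::
  "(real^'n \<Rightarrow> real^'n) \<Rightarrow> (real \<Rightarrow> real^'n) \<Rightarrow> real
     \<Rightarrow> real^'n \<Rightarrow> real^'n \<Rightarrow> real^'n \<Rightarrow> real^'n" where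
  "Cform F u0 \<tau> w1 w2 w3 = D3 F (u0 \<tau>) w1 w2 w3"

definition fundamental_matrix ::
  "(real^'n \<Rightarrow> real^'n) \<Rightarrow> (real \<Rightarrow> real^'n) \<Rightarrow> real \<Rightarrow> (real \<Rightarrow> real^'n^'n) \<Rightarrow> bool" where
  "fundamental_matrix F u0 T Y \<longleftrightarrow>
     (\<forall>\<tau>\<in>{0..T}. (Y has_vector_derivative Amat F u0 \<tau> ** Y \<tau>) (at \<tau> within {0..T})) \<and>
     Y 0 = mat 1"

definition charpoly :: "'a::comm_ring_1^'n^'n \<Rightarrow> 'a poly" where
  "charpoly M = det (mat [:0, 1:] - map_matrix (\<lambda>a. [:a:]) M)"

definition eigval :: "complex^'n^'n \<Rightarrow> complex \<Rightarrow> bool" where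
  "eigval M \<mu> \<longleftrightarrow> (\<exists>z. z \<noteq> 0 \<and> M *v z = \<mu> *s z)"

(* For the monodromy matrix M: the eigenvalue 1 has algebraic multiplicity 2 and carries a
   Jordan chain of length 2, and no other eigenvalue lies on the unit circle. *)
definition CPC_multipliers :: "real^'n^'n \<Rightarrow> bool" where
  "CPC_multipliers M \<longleftrightarrow>
     order 1 (charpoly M) = 2 \<and>
     (\<exists>q1 q2. q1 \<noteq> 0 \<and> M *v q1 = q1 \<and> M *v q2 = q2 + q1) \<and>
     (\<forall>\<mu>. eigval (map_matrix complex_of_real M) \<mu> \<and> cmod \<mu> = 1 \<longrightarrow> \<mu> = 1)"

definition v_bvp ::
  "(real^'n \<Rightarrow> real^'n) \<Rightarrow> (real \<Rightarrow> real^'n) \<Rightarrow> real \<Rightarrow> (real \<Rightarrow> real^'n) \<Rightarrow> bool" where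
  "v_bvp F u0 T v \<longleftrightarrow>
     (\<forall>\<tau>\<in>{0..T}. (v has_vector_derivative Amat F u0 \<tau> *v v \<tau> + F (u0 \<tau>))
        (at \<tau> within {0..T})) \<and>
     v T = v 0 \<and>
     integral {0..T} (\<lambda>\<tau>. v \<tau> \<bullet> F (u0 \<tau>)) = 0"

definition phi_star_bvp ::
  "(real^'n \<Rightarrow> real^'n) \<Rightarrow> (real \<Rightarrow> real^'n) \<Rightarrow> real
     \<Rightarrow> (real \<Rightarrow> real^'n) \<Rightarrow> (real \<Rightarrow> real^'n) \<Rightarrow> bool" where
  "phi_star_bvp F u0 T v \<phi>s \<longleftrightarrow>
     (\<forall>\<tau>\<in>{0..T}. (\<phi>s has_vector_derivative - (transpose (Amat F u0 \<tau>) *v \<phi>s \<tau>))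
        (at \<tau> within {0..T})) \<and>
     \<phi>s T = \<phi>s 0 \<and>
     integral {0..T} (\<lambda>\<tau>. \<phi>s \<tau> \<bullet> v \<tau>) = 1"

definition v_star_bvp ::
  "(real^'n \<Rightarrow> real^'n) \<Rightarrow> (real \<Rightarrow> real^'n) \<Rightarrow> real
     \<Rightarrow> (real \<Rightarrow> real^'n) \<Rightarrow> (real \<Rightarrow> real^'n) \<Rightarrow> (real \<Rightarrow> real^'n) \<Rightarrow> bool" where
  "v_star_bvp F u0 T v \<phi>s vs \<longleftrightarrow>
     (\<forall>\<tau>\<in>{0..T}. (vs has_vector_derivative - (transpose (Amat F u0 \<tau>) *v vs \<tau>) - \<phi>s \<tau>)
        (at \<tau> within {0..T})) \<and>
     vs T = vs 0 \<and>
     integral {0..T} (\<lambda>\<tau>. vs \<tau> \<bullet> v \<tau>) = 0"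

definition h2_bvp ::
  "(real^'n \<Rightarrow> real^'n) \<Rightarrow> (real \<Rightarrow> real^'n) \<Rightarrow> real
     \<Rightarrow> (real \<Rightarrow> real^'n) \<Rightarrow> (real \<Rightarrow> real^'n) \<Rightarrow> real \<Rightarrow> (real \<Rightarrow> real^'n) \<Rightarrow> bool" where
  "h2_bvp F u0 T v vs \<alpha>1 h2 \<longleftrightarrow>
     (\<forall>\<tau>\<in>{0..T}. (h2 has_vector_derivative
          Amat F u0 \<tau> *v h2 \<tau> + Bform F u0 \<tau> (v \<tau>) (v \<tau>) + 2 *\<^sub>R (Amat F u0 \<tau> *v v \<tau>)
          + 2 *\<^sub>R F (u0 \<tau>) - (2 * \<alpha>1) *\<^sub>R F (u0 \<tau>)) (at \<tau> within {0..T})) \<and>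
     h2 T - h2 0 = 0 \<and>
     integral {0..T} (\<lambda>\<tau>. vs \<tau> \<bullet> h2 \<tau>) = 0"

definition c_formula ::
  "(real^'n \<Rightarrow> real^'n) \<Rightarrow> (real \<Rightarrow> real^'n) \<Rightarrow> real
     \<Rightarrow> (real \<Rightarrow> real^'n) \<Rightarrow> (real \<Rightarrow> real^'n) \<Rightarrow> real \<Rightarrow> (real \<Rightarrow> real^'n) \<Rightarrow> real" where
  "c_formula F u0 T v \<phi>s \<alpha>1 h2 =
     1 / 6 * integral {0..T} (\<lambda>\<tau>. \<phi>s \<tau> \<bullet>
       (- (6 * \<alpha>1) *\<^sub>R (Amat F u0 \<tau> *v v \<tau>)
        + 3 *\<^sub>R (Amat F u0 \<tau> *v h2 \<tau>)
        + 3 *\<^sub>R Bform F u0 \<tau> (v \<tau>) (v \<tau>)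
        + 6 *\<^sub>R (Amat F u0 \<tau> *v v \<tau>)
        + 3 *\<^sub>R Bform F u0 \<tau> (h2 \<tau>) (v \<tau>)
        + Cform F u0 \<tau> (v \<tau>) (v \<tau>) (v \<tau>)))"

(* The critical center manifold near the cycle, parametrized by
     U (tau, xi) = u0 tau + xi v tau + H (tau, xi),  |xi| < delta,
   with restricted dynamics tau' = P (tau, xi), xi' = Q (tau, xi) in CPC normal form.
   Along the cycle the tangent plane of U is spanned by F (u0 tau) and v tau, which is the
   critical center subspace; local invariance is the last clause.  The remainders of P and Q
   are required to be C^1 so that the restricted system has a local solution through every
   point, without which the last clause would carry no information.  v, given by a periodic
   boundary value problem on [0, T], has to be its T-periodic extension. *)
definition CPC_center_manifold ::
  "(real^'n \<Rightarrow> real^'n) \<Rightarrow> (real \<Rightarrow> real^'n) \<Rightarrow> real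
     \<Rightarrow> (real \<Rightarrow> real^'n) \<Rightarrow> (real \<Rightarrow> real^'n) \<Rightarrow> real \<Rightarrow> real \<Rightarrow> real \<Rightarrow> bool" where
  "CPC_center_manifold F u0 T v vs a1 a2 c \<longleftrightarrow>
     (\<forall>\<tau>. v (\<tau> + T) = v \<tau>) \<and>
     (\<exists>\<delta> H h2 h3 R S U P Q. 0 < \<delta> \<and>
        Ck_on 4 (UNIV \<times> {-\<delta><..<\<delta>}) H \<and>
        (\<forall>\<tau> \<xi>. \<bar>\<xi>\<bar> < \<delta> \<longrightarrow> H (\<tau> + T, \<xi>) = H (\<tau>, \<xi>)) \<and>
        (\<forall>\<tau>. (\<lambda>\<xi>. norm (H (\<tau>, \<xi>) - (\<xi>^2 / 2) *\<^sub>R h2 \<tau> - (\<xi>^3 / 6) *\<^sub>R h3 \<tau>))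
                \<in> O[at 0](\<lambda>\<xi>. \<xi>^4)) \<and>
        integral {0..T} (\<lambda>\<tau>. vs \<tau> \<bullet> h2 \<tau>) = 0 \<and>
        Ck_on 1 (UNIV \<times> {-\<delta><..<\<delta>}) R \<and>
        Ck_on 1 (UNIV \<times> {-\<delta><..<\<delta>}) S \<and>
        (\<forall>\<tau> \<xi>. \<bar>\<xi>\<bar> < \<delta> \<longrightarrow> R (\<tau> + T, \<xi>) = R (\<tau>, \<xi>) \<and> S (\<tau> + T, \<xi>) = S (\<tau>, \<xi>)) \<and>
        (\<forall>\<tau>. (\<lambda>\<xi>. R (\<tau>, \<xi>)) \<in> O[at 0](\<lambda>\<xi>. \<xi>^4) \<and> (\<lambda>\<xi>. S (\<tau>, \<xi>)) \<in> O[at 0](\<lambda>\<xi>. \<xi>^4)) \<and>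
        U = (\<lambda>(\<tau>, \<xi>). u0 \<tau> + \<xi> *\<^sub>R v \<tau> + H (\<tau>, \<xi>)) \<and>
        P = (\<lambda>(\<tau>, \<xi>). 1 - \<xi> + a1 * \<xi>^2 + a2 * \<xi>^3 + R (\<tau>, \<xi>)) \<and>
        Q = (\<lambda>(\<tau>, \<xi>). c * \<xi>^3 + S (\<tau>, \<xi>)) \<and>
        (\<forall>a b x y.
           (\<forall>t\<in>{a<..<b::real}. \<bar>y t\<bar> < \<delta> \<and>
              (x has_real_derivative P (x t, y t)) (at t) \<and>
              (y has_real_derivative Q (x t, y t)) (at t)) \<longrightarrow>
           (\<forall>t\<in>{a<..<b}. ((\<lambda>t. U (x t, y t)) has_vector_derivative F (U (x t, y t))) (at t))))"

end

theory Submission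
  imports Defs
begin

text \<open>
  Local solutions of the restricted system turn the invariance of the center manifold into the
  homological equation \<open>U\<^sub>\<tau> P + U\<^sub>\<xi> Q = F \<circ> U\<close>. Its coefficients of \<open>\<xi>\<^sup>2\<close> and \<open>\<xi>\<^sup>3\<close> say that
  \<open>h2\<close> solves the boundary value problem with \<open>\<alpha>1 = a1\<close> and that \<open>h3\<close> solves a linear periodic
  problem whose inhomogeneity contains \<open>- 6 c v\<close>. Pairing the latter with the adjoint solution
  \<open>\<phi>*\<close>, which annihilates \<open>F (u0 \<tau>)\<close> and has pairing 1 with \<open>v\<close>, isolates \<open>c\<close>; pairing the equation for
  \<open>h2\<close> with \<open>\<phi>*\<close> makes the formula independent of \<open>\<alpha>1\<close>. Uniqueness holds because the periodic
  solutions of the variational equation are the multiples of \<open>F (u0 \<tau>)\<close> (a further one would make the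
  algebraic multiplicity of the multiplier 1 at least 3), and \<open>v*\<close> has pairing 1 with \<open>F (u0 \<tau>)\<close>.
\<close>

subsection \<open>Local solutions and invariance\<close>

text \<open>The obstacle is the \<tau>-derivative of \<open>H\<close>. The manifold is given with an
  expansion \<open>\<xi>^2/2 h2 + \<xi>^3/6 h3 + O(\<xi>^4)\<close> at each \<tau> separately,
  without uniformity and without regularity of \<open>h2\<close> and \<open>h3\<close>, and an
  asymptotic expansion cannot be differentiated term by term. Since \<open>H\<close> is of class C4,
  its \<tau>-derivative has a Taylor expansion in \<xi> that is uniform for \<tau> in compact
  intervals; integrating that one and comparing coefficients shows that \<open>h2\<close> and
  \<open>h3\<close> are differentiable. A second theme is that \<open>Ck_on\<close> speaks of
  derivatives in fixed directions. Operator bounds, Lipschitz constants and joint continuity are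
  recovered by expanding directions in \<open>Basis\<close>. Existence in the problem for
  \<open>h2\<close> comes from the manifold itself: it supplies a solution for the parameter
  \<open>a1\<close>, and adding a multiple of \<open>v\<close> reaches every other
  parameter.\<close>

lemma local_solution:
  fixes f :: "'a::euclidean_space \<Rightarrow> 'a"
  assumes L: "L-lipschitz_on (cball x0 r) f" and r: "0 < r"
  obtains h x where "0 < h" "x 0 = x0"
    "\<And>t. \<bar>t\<bar> < h \<Longrightarrow> x t \<in> cball x0 r \<and> (x has_vector_derivative f (x t)) (at t)"
proof -
  \<comment> \<open>Composing with the nearest-point projection onto the ball makes the field
    globally Lipschitz with the same constant, so Picard iteration can run on all bounded continuous
    functions; on the ball \<open>g\<close> is \<open>f\<close>.\<close>
  define g where "g y = f (closest_point (cball x0 r) y)" for y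
  \<comment> \<open>The 6 comes from the contraction estimate below: the integral up to
    \<open>c t\<close> has length at most \<open>2 * h\<close> and the one up to 0 has length
    \<open>h\<close>, which gives the factor \<open>3 * h * L\<close>. Adding 1 to \<open>L\<close>
    covers \<open>L = 0\<close>.\<close>
  define h where "h = 1 / (6 * (L + 1))"
  have L0: "0 \<le> L" using L by (rule lipschitz_on_nonneg)
  then have h: "0 < h" "3 * h * L \<le> 1 / 2" by (auto simp: h_def field_simps)
  have ne: "cball x0 r \<noteq> {}" using r by auto
  have glip: "dist (g y) (g z) \<le> L * dist y z" for y z
  proof -
    have "dist (g y) (g z) \<le> L * dist (closest_point (cball x0 r) y) (closest_point (cball x0 r) z)"
      unfolding g_def by (rule lipschitz_onD[OF L]) (use ne in \<open>auto intro: closest_point_in_set simp del: mem_cball\<close>)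
    also have "\<dots> \<le> L * dist y z"
      by (intro mult_left_mono closest_point_lipschitz L0) (use ne in auto)
    finally show ?thesis .
  qed
  have "continuous_on UNIV g"
    by (rule lipschitz_on_continuous_on[of L]) (auto simp: lipschitz_on_def L0 glip)
  then have gc: "continuous_on S (\<lambda>t. g (apply_bcontfun \<phi> t))" for S :: "real set" and \<phi>
    by (rule continuous_on_compose2) auto
  \<comment> \<open>Clamping time to \<open>{-h..h}\<close> turns the Picard operator into a map of
    bounded continuous functions on the whole line, a complete metric space.\<close>
  define c :: "real \<Rightarrow> real" where "c t = max (- h) (min h t)" for t
  have c: "c t \<in> {-h..h}" "\<bar>t\<bar> < h \<Longrightarrow> c t = t" for t using h by (auto simp: c_def)
  \<comment> \<open>The difference of two integrals from \<open>-h\<close> is the signed integral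
    from 0 to \<open>u\<close>, also for negative \<open>u\<close>.\<close>
  define I where "I \<phi> u = x0 + (integral {-h..u} (\<lambda>t. g (apply_bcontfun \<phi> t)) - integral {-h..0} (\<lambda>t. g (apply_bcontfun \<phi> t)))" for \<phi> u
  have Ic: "continuous_on {-h..h} (I \<phi>)" for \<phi>
    unfolding I_def by (intro continuous_intros indefinite_integral_continuous_1 integrable_continuous_interval gc)
  have bc: "(\<lambda>t. I \<phi> (c t)) \<in> bcontfun" for \<phi>
  proof -
    have "continuous_on UNIV (\<lambda>t. I \<phi> (c t))"
      by (rule continuous_on_compose2[OF Ic[of \<phi>]]) (use c in \<open>auto simp: c_def intro!: continuous_intros\<close>)
    moreover have "bounded (range (\<lambda>t. I \<phi> (c t)))"
      by (rule bounded_subset[OF compact_imp_bounded[OF compact_continuous_image[OF Ic[of \<phi>] compact_Icc]]])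
        (use c in auto)
    ultimately show ?thesis by (simp add: bcontfun_def)
  qed
  have "\<exists>!\<phi>. Bcontfun (\<lambda>t. I \<phi> (c t)) = \<phi>"
  proof (rule banach_fix_type[of "1/2"], simp, simp, intro allI)
    fix \<phi> \<psi> :: "real \<Rightarrow>\<^sub>C 'a"
    have bd: "norm (integral {-h..u} (\<lambda>t. g (\<phi> t)) - integral {-h..u} (\<lambda>t. g (\<psi> t))) \<le> (L * dist \<phi> \<psi>) * (u + h)" if "- h \<le> u" for u
    proof -
      have "integral {-h..u} (\<lambda>t. g (\<phi> t)) - integral {-h..u} (\<lambda>t. g (\<psi> t)) = integral {-h..u} (\<lambda>t. g (\<phi> t) - g (\<psi> t))"
        by (intro integral_diff[symmetric] integrable_continuous_interval gc)
      also have "norm \<dots> \<le> (L * dist \<phi> \<psi>) * (u - (- h))"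
      proof (rule integral_bound[OF that])
        show "continuous_on {- h..u} (\<lambda>t. g (apply_bcontfun \<phi> t) - g (apply_bcontfun \<psi> t))"
          by (intro continuous_intros gc)
        fix t show "norm (g (\<phi> t) - g (\<psi> t)) \<le> L * dist \<phi> \<psi>"
          using glip[of "\<phi> t" "\<psi> t"] mult_left_mono[OF dist_bounded[of \<phi> t \<psi>] L0] by (simp add: dist_norm)
      qed
      finally show ?thesis by simp
    qed
    show "dist (Bcontfun (\<lambda>t. I \<phi> (c t))) (Bcontfun (\<lambda>t. I \<psi> (c t))) \<le> 1/2 * dist \<phi> \<psi>"
    proof (rule dist_bound)
      fix t
      let ?D = "\<lambda>u. integral {-h..u} (\<lambda>t. g (\<phi> t)) - integral {-h..u} (\<lambda>t. g (\<psi> t))"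
      have "dist (I \<phi> (c t)) (I \<psi> (c t)) = norm (?D (c t) - ?D 0)"
        by (simp add: I_def dist_norm algebra_simps)
      also have "\<dots> \<le> (L * dist \<phi> \<psi>) * (c t + h) + (L * dist \<phi> \<psi>) * (0 + h)"
        using bd[of "c t"] bd[of 0] h c(1)[of t] norm_triangle_ineq4[of "?D (c t)" "?D 0"] by force
      also have "\<dots> \<le> (L * dist \<phi> \<psi>) * (h + h) + (L * dist \<phi> \<psi>) * (0 + h)"
        using c(1)[of t] L0 by (intro add_mono mult_left_mono) auto
      also have "\<dots> = (3 * h * L) * dist \<phi> \<psi>" by (simp add: algebra_simps)
      also have "\<dots> \<le> 1/2 * dist \<phi> \<psi>" by (rule mult_right_mono[OF h(2)]) simp
      finally show "dist (Bcontfun (\<lambda>t. I \<phi> (c t)) t) (Bcontfun (\<lambda>t. I \<psi> (c t)) t) \<le> 1/2 * dist \<phi> \<psi>"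
        by (simp add: Bcontfun_inverse[OF bc])
    qed
  qed
  then obtain \<phi> where "Bcontfun (\<lambda>t. I \<phi> (c t)) = \<phi>" by auto
  then have fp: "apply_bcontfun \<phi> t = I \<phi> (c t)" for t
    by (metis Bcontfun_inverse[OF bc])
  have \<phi>0: "\<phi> 0 = x0" using h c(2)[of 0] fp[of 0] by (simp add: I_def)
  have der: "(\<phi> has_vector_derivative g (\<phi> t)) (at t)" if "\<bar>t\<bar> < h" for t
  proof -
    have "((\<lambda>u. integral {-h..u} (\<lambda>t. g (\<phi> t))) has_vector_derivative g (\<phi> t)) (at t within {-h..h})"
      by (rule integral_has_vector_derivative[OF gc]) (use that in auto)
    then have "((\<lambda>u. integral {-h..u} (\<lambda>t. g (\<phi> t))) has_vector_derivative g (\<phi> t)) (at t)"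
      using that by (simp add: at_within_Icc_at)
    then have "(I \<phi> has_vector_derivative g (\<phi> t)) (at t)"
      unfolding I_def by (auto intro!: derivative_eq_intros)
    then show ?thesis
      by (rule has_vector_derivative_transform_within_open[where S="{-h<..<h}"]) (use that c fp in auto)
  qed
  \<comment> \<open>Continuity at 0 keeps the fixed point inside the ball for a short time, where it
    solves the original equation.\<close>
  have "isCont (apply_bcontfun \<phi>) 0"
    using continuous_on_apply_bcontfun[of UNIV \<phi>] continuous_on_eq_continuous_at[of UNIV "apply_bcontfun \<phi>"]
    by blast
  then obtain d where d: "d > 0" "\<And>t. dist t 0 < d \<Longrightarrow> dist (\<phi> t) (\<phi> 0) < r"
    using r unfolding continuous_at_eps_delta by blast
  show ?thesis
  proof (rule that[of "min h d" "apply_bcontfun \<phi>"])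
    fix t :: real assume t: "\<bar>t\<bar> < min h d"
    then have "\<phi> t \<in> cball x0 r" using d(2)[of t] \<phi>0 by (simp add: dist_commute)
    moreover from this have "g (\<phi> t) = f (\<phi> t)" by (simp add: g_def closest_point_self)
    ultimately show "\<phi> t \<in> cball x0 r \<and> (\<phi> has_vector_derivative f (\<phi> t)) (at t)"
      using der[of t] t by simp
  qed (use h d \<phi>0 in auto)
qed


text \<open>On a compact ball each basis direction has a bound for the derivative. Expanding an
  arbitrary direction in \<open>Basis\<close> makes the sum of these bounds a bound for the operator
  norm, and the ball is convex.\<close>

lemma locally_lipschitz_of_C1:
  fixes f :: "'a::euclidean_space \<Rightarrow> 'b::real_normed_vector"
  assumes S: "open S" "x0 \<in> S"
    and der: "\<And>p. p \<in> S \<Longrightarrow> (f has_derivative f' p) (at p)"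
    and cont: "\<And>w. continuous_on S (\<lambda>p. f' p w)"
  obtains L r where "0 < r" "cball x0 r \<subseteq> S" "L-lipschitz_on (cball x0 r) f"
proof -
  obtain r where r: "0 < r" "cball x0 r \<subseteq> S" using S open_contains_cball by blast
  have "\<exists>B. \<forall>p\<in>cball x0 r. norm (f' p b) \<le> B" for b
    using compact_imp_bounded[OF compact_continuous_image[OF continuous_on_subset[OF cont[of b] r(2)] compact_cball]]
    unfolding bounded_iff by auto
  then obtain B where B: "\<And>b p. p \<in> cball x0 r \<Longrightarrow> norm (f' p b) \<le> B b" by metis
  have B0: "0 \<le> B b" for b
    by (rule order_trans[OF norm_ge_zero B[of x0]]) (use r in auto)
  have on: "norm (f' p w) \<le> (\<Sum>b\<in>Basis. B b) * norm w" if "p \<in> cball x0 r" for p w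
  proof -
    have lin: "linear (f' p)" using der[of p] that r has_derivative_linear by blast
    have "f' p w = (\<Sum>b\<in>Basis. (w \<bullet> b) *\<^sub>R f' p b)"
      using arg_cong[OF euclidean_representation[of w], of "f' p"]
      by (simp add: linear_sum[OF lin] linear_cmul[OF lin])
    also have "norm \<dots> \<le> (\<Sum>b\<in>Basis. norm w * B b)"
      by (rule sum_norm_le) (auto intro!: mult_mono B that Basis_le_norm)
    finally show ?thesis by (simp add: sum_distrib_left mult.commute)
  qed
  have "(\<Sum>b\<in>Basis. B b)-lipschitz_on (cball x0 r) f"
  proof (rule bounded_derivative_imp_lipschitz)
    fix p assume p: "p \<in> cball x0 r"
    show "(f has_derivative f' p) (at p within cball x0 r)"
      using der[of p] p r has_derivative_at_withinI by blast
    show "onorm (f' p) \<le> (\<Sum>b\<in>Basis. B b)" by (rule onorm_bound) (auto intro: sum_nonneg B0 on[OF p])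
  qed (auto intro: sum_nonneg B0)
  with r show ?thesis by (rule that)
qed

text \<open>A solution of the restricted system through the given point exists for a short time.
  Differentiating \<open>U\<close> along it at time 0, once by the chain rule and once by
  invariance, gives two vector derivatives of one curve.\<close>

lemma invariance_equation:
  fixes U :: "real \<times> real \<Rightarrow> 'b::real_normed_vector" and P Q :: "real \<times> real \<Rightarrow> real"
  assumes lip: "L-lipschitz_on (cball (\<tau>, \<xi>) r) (\<lambda>p. (P p, Q p))" "0 < r"
    and sub: "cball (\<tau>, \<xi>) r \<subseteq> UNIV \<times> {-\<delta><..<\<delta>}"
    and U: "(U has_derivative U') (at (\<tau>, \<xi>))"
    and inv: "\<And>a b x y t. \<lbrakk>\<And>t. t \<in> {a<..<b::real} \<Longrightarrow> \<bar>y t\<bar> < \<delta> \<and>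
              (x has_real_derivative P (x t, y t)) (at t) \<and>
              (y has_real_derivative Q (x t, y t)) (at t); t \<in> {a<..<b}\<rbrakk> \<Longrightarrow>
           ((\<lambda>t. U (x t, y t)) has_vector_derivative F (U (x t, y t))) (at t)"
  shows "U' (P (\<tau>, \<xi>), Q (\<tau>, \<xi>)) = F (U (\<tau>, \<xi>))"
proof -
  obtain h z where h: "0 < h" and z0: "z 0 = (\<tau>, \<xi>)"
    and z: "\<And>t. \<bar>t\<bar> < h \<Longrightarrow> z t \<in> cball (\<tau>, \<xi>) r \<and> (z has_vector_derivative (P (z t), Q (z t))) (at t)"
    by (rule local_solution[OF lip]) blast
  have "((\<lambda>t. U (fst (z t), snd (z t))) has_vector_derivative F (U (fst (z 0), snd (z 0)))) (at 0)"
  proof (rule inv[of "-h" h])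
    fix t assume "t \<in> {-h<..<h}"
    then have t: "\<bar>t\<bar> < h" by auto
    have "z t \<in> UNIV \<times> {-\<delta><..<\<delta>}" using z[OF t] sub by blast
    then have "\<bar>snd (z t)\<bar> < \<delta>" by auto
    show "\<bar>snd (z t)\<bar> < \<delta> \<and> ((\<lambda>t. fst (z t)) has_real_derivative P (fst (z t), snd (z t))) (at t) \<and>
          ((\<lambda>t. snd (z t)) has_real_derivative Q (fst (z t), snd (z t))) (at t)"
      using z[OF t] \<open>\<bar>snd (z t)\<bar> < \<delta>\<close>
        bounded_linear.has_vector_derivative[OF bounded_linear_fst, of z "(P (z t), Q (z t))" "at t"]
        bounded_linear.has_vector_derivative[OF bounded_linear_snd, of z "(P (z t), Q (z t))" "at t"]
      by (auto simp: has_real_derivative_iff_has_vector_derivative simp del: mem_cball)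
  qed (use h in auto)
  then have 1: "((\<lambda>t. U (z t)) has_vector_derivative F (U (\<tau>, \<xi>))) (at 0)" by (simp add: z0)
  have "((U \<circ> z) has_derivative (U' \<circ> (\<lambda>t. t *\<^sub>R (P (z 0), Q (z 0))))) (at 0)"
    using z[of 0] h U by (intro diff_chain_at) (auto simp: has_vector_derivative_def z0)
  moreover have "linear U'" using U has_derivative_linear by blast
  ultimately have 2: "((\<lambda>t. U (z t)) has_vector_derivative U' (P (\<tau>, \<xi>), Q (\<tau>, \<xi>))) (at 0)"
    by (simp add: has_vector_derivative_def o_def z0 linear_cmul del: scaleR_Pair)
  from 2 1 show ?thesis by (rule vector_derivative_unique_at)
qed

subsection \<open>The eigenvalue 1 of the monodromy matrix\<close>

text \<open>Divisibility by a power bounds \<open>order\<close> from below only for a nonzero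
  polynomial. At an \<open>x\<close> above the operator norm of \<open>M\<close> the matrix
  \<open>mat x - M\<close> is injective, so the polynomial does not vanish there.\<close>

lemma charpoly_nonzero: "charpoly (M :: real^'n^'n) \<noteq> 0"
proof -
  define x where "x = onorm ((*v) M) + 1"
  have "poly (charpoly M) x = det (mat x - M)"
    unfolding charpoly_def det_def
    by (simp add: poly_sum poly_prod mat_def of_int_poly)
      (auto intro!: sum.cong prod.cong arg_cong2[of _ _ _ _ "(*)"] simp: mat_def)
  moreover have "det (mat x - M) \<noteq> 0"
    unfolding invertible_det_nz[symmetric] invertible_left_inverse matrix_left_invertible_ker
  proof (intro allI impI)
    fix z assume "(mat x - M) *v z = 0"
    moreover have "mat x *v z = x *\<^sub>R z"
      by (simp add: mat_def matrix_vector_mult_def vec_eq_iff if_distrib[of "\<lambda>y. y * _"] cong: if_cong)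
    ultimately have "M *v z = x *\<^sub>R z" by (simp add: matrix_vector_mult_diff_rdistrib)
    moreover have "norm (M *v z) \<le> onorm ((*v) M) * norm z"
      by (rule onorm) (simp add: matrix_vector_mul_bounded_linear)
    moreover have "0 \<le> onorm ((*v) M)"
      by (rule onorm_pos_le) (simp add: matrix_vector_mul_bounded_linear)
    ultimately have "x * norm z \<le> onorm ((*v) M) * norm z" "0 \<le> onorm ((*v) M)" by (simp_all add: x_def)
    then show "z = 0" by (simp add: x_def algebra_simps)
  qed
  ultimately show ?thesis by auto
qed

text \<open>The columns describe two fixed basis vectors and a Jordan chain above the first. In the
  transposed characteristic matrix, rows \<open>i\<close> and \<open>j\<close> are multiples of
  \<open>X - 1\<close>; row \<open>k\<close> becomes one after adding row \<open>i\<close>, from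
  which its factor has already been extracted. Each of the three rows yields a factor.\<close>

lemma cube_dvd_charpoly:
  fixes N :: "'a::comm_ring_1^'n^'n"
  assumes ij: "i \<noteq> j" "i \<noteq> k" "j \<noteq> k"
    and ci: "column i N = axis i 1" and cj: "column j N = axis j 1"
    and ck: "column k N = axis k 1 + axis i 1"
  shows "[:-1, 1:] ^ 3 dvd charpoly N"
proof -
  define c :: "'a poly" where "c = [:-1, 1:]"
  define Z where "Z = transpose (mat [:0, 1:] - map_matrix (\<lambda>a. [:a:]) N)"
  have Z: "Z $ r $ s = (if r = s then [:0, 1:] else 0) - [:N $ s $ r:]" for r s
    by (simp add: Z_def transpose_def mat_def eq_commute)
  have N: "N $ s $ i = axis i 1 $ s" "N $ s $ j = axis j 1 $ s" "N $ s $ k = (axis k 1 + axis i 1) $ s" for s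
    using ci cj ck by (metis column_def vec_lambda_beta)+
  have Zi: "Z $ i = c *s axis i 1" and Zj: "Z $ j = c *s axis j 1" and Zk: "Z $ k = c *s axis k 1 - axis i 1"
    by (auto simp: vec_eq_iff Z N c_def axis_def one_pCons)
  have "charpoly N = det Z" by (simp add: Z_def charpoly_def)
  also have "Z = (\<chi> r. if r = i then c *s axis i 1 else Z $ r)" by (simp add: vec_eq_iff Zi)
  also have "det \<dots> = c * det (\<chi> r. if r = i then axis i 1 else Z $ r)" by (rule det_row_mul)
  also have "det (\<chi> r. if r = i then axis i 1 else Z $ r) =
      det (\<chi> r. if r = k then row k (\<chi> r. if r = i then axis i 1 else Z $ r) + 1 *s row i (\<chi> r. if r = i then axis i 1 else Z $ r)
              else row r (\<chi> r. if r = i then axis i 1 else Z $ r))"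
    using ij by (intro det_row_operation[symmetric]) auto
  also have "(\<chi> r. if r = k then row k (\<chi> r. if r = i then axis i 1 else Z $ r) + 1 *s row i (\<chi> r. if r = i then axis i 1 else Z $ r)
              else row r (\<chi> r. if r = i then axis i 1 else Z $ r))
      = (\<chi> r. if r = k then c *s axis k 1 else if r = i then axis i 1 else Z $ r)"
    using ij by (simp add: vec_eq_iff row_def Zk)
  also have "det \<dots> = c * det (\<chi> r. if r = k then axis k 1 else if r = i then axis i 1 else Z $ r)"
    by (rule det_row_mul)
  also have "(\<chi> r. if r = k then axis k 1 else if r = i then axis i 1 else Z $ r)
      = (\<chi> r. if r = j then c *s axis j 1 else if r = k then axis k 1 else if r = i then axis i 1 else Z $ r)"
    using ij by (simp add: vec_eq_iff Zj)
  also have "det \<dots> = c * det (\<chi> r. if r = j then axis j 1 else if r = k then axis k 1 else if r = i then axis i 1 else Z $ r)"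
    by (rule det_row_mul)
  finally have "charpoly N = c ^ 3 * det (\<chi> r. if r = j then axis j 1 else if r = k then axis k 1 else if r = i then axis i 1 else Z $ r)"
    by (simp only: power3_eq_cube mult.assoc)
  then show ?thesis unfolding c_def by (rule dvdI)
qed

text \<open>The similarity is moved to polynomial matrices by the embedding \<open>e\<close> of
  constants, and the scalar matrix \<open>X\<close> commutes with everything. The determinant of
  \<open>e W\<close> is cancelled by multiplying with its inverse \<open>det (e V)\<close>.\<close>

lemma charpoly_similar:
  fixes M N W V :: "'a::comm_ring_1^'n^'n"
  assumes VW: "V ** W = mat 1" and MW: "M ** W = W ** N"
  shows "charpoly M = charpoly N"
proof -
  define e :: "'a^'n^'n \<Rightarrow> 'a poly^'n^'n" where "e = map_matrix (\<lambda>a. [:a:])"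
  have pCons_sum: "(\<Sum>a\<in>A. [:f a:]) = [:sum f A:]" for f :: "'n \<Rightarrow> 'a" and A
    by (induction A rule: infinite_finite_induct) auto
  have e_mult: "e (A ** B) = e A ** e B" for A B
    by (simp add: e_def vec_eq_iff matrix_matrix_mult_def pCons_sum mult.commute)
  have e_1: "e (mat 1) = mat 1" by (simp add: e_def vec_eq_iff mat_def one_pCons)
  define X :: "'a poly^'n^'n" where "X = mat [:0, 1:]"
  have X: "X ** A = A ** X" for A
    by (simp add: X_def vec_eq_iff matrix_matrix_mult_def mat_def if_distrib[of "\<lambda>y. y * _"]
        if_distrib[of "\<lambda>y. _ * y"] mult.commute cong: if_cong)
  have dd: "det (e V) * det (e W) = 1"
    using e_mult[of V W] VW e_1 by (metis det_I det_mul)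
  have "(X - e M) ** e W = e W ** (X - e N)"
    using e_mult[of M W] e_mult[of W N] MW X[of "e W"]
    by (simp add: vec_eq_iff matrix_matrix_mult_def left_diff_distrib right_diff_distrib sum_subtractf)
  then have "det (X - e M) * det (e W) = det (e W) * det (X - e N)" by (metis det_mul)
  then have "det (X - e M) * (det (e V) * det (e W)) = (det (e V) * det (e W)) * det (X - e N)"
    by (simp add: ac_simps)
  with dd show ?thesis by (simp add: charpoly_def X_def e_def)
qed

text \<open>A fixed vector \<open>p\<close> off the line of \<open>q1\<close> would be independent
  of \<open>q1\<close>, and \<open>q2\<close>, which \<open>M\<close> moves, lies outside the span
  of these fixed vectors. Completing \<open>q2\<close>, \<open>p\<close>, \<open>q1\<close> to a
  basis brings \<open>M\<close> into the form of \<open>cube_dvd_charpoly\<close>, so the root 1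
  would have order at least 3.\<close>

lemma jordan_chain_kernel:
  fixes M :: "real^'n^'n"
  assumes ord: "order 1 (charpoly M) = 2"
    and q1: "q1 \<noteq> 0" "M *v q1 = q1" and q2: "M *v q2 = q2 + q1" and p: "M *v p = p"
  shows "p \<in> span {q1}"
proof (rule ccontr)
  assume pn: "p \<notin> span {q1}"
  have q2n: "q2 \<notin> span {p, q1}"
  proof
    assume "q2 \<in> span {p, q1}"
    then have "M *v q2 = q2"
      by (induction rule: span_induct_alt)
        (auto simp: matrix_vector_right_distrib matrix_vector_mult_scaleR p q1)
    with q2 q1 show False by simp
  qed
  have ind: "independent {q2, p, q1}" using q1 pn q2n by (simp add: independent_insert)
  obtain B where B: "{q2, p, q1} \<subseteq> B" "independent B" "span B = UNIV"
    using maximal_independent_subset_extend[OF subset_UNIV ind] by (metis UNIV_I UNIV_eq_I subsetD)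
  have "card B = CARD('n)" using dim_eq_card_independent[OF B(2)] dim_span[of B] B(3) by (simp add: dim_UNIV)
  moreover have "finite B" using B(2) independent_bound by blast
  ultimately obtain f :: "'n \<Rightarrow> real^'n" where f: "bij_betw f UNIV B"
    using finite_same_card_bij[of "UNIV :: 'n set" B] by auto
  then obtain i j k where ijk: "f i = q1" "f j = p" "f k = q2"
    using B(1) unfolding bij_betw_def by (metis imageE insert_subset)
  have neq: "q1 \<noteq> p" "q1 \<noteq> q2" "p \<noteq> q2"
    using pn q2n by (auto simp: span_base)
  \<comment> \<open>The columns of \<open>W\<close> are the basis vectors, so \<open>N\<close> below
    is the matrix of \<open>M\<close> in that basis.\<close>
  define W where "W = transpose (vec_lambda f)"
  have W: "column b W = f b" for b by (simp add: W_def column_def transpose_def vec_eq_iff)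
  have "columns W = B" using f by (auto simp: columns_def W bij_betw_def)
  then have "\<exists>V. W ** V = mat 1" unfolding matrix_right_invertible_span_columns using B(3) by (simp add: span_vec_eq)
  then obtain V where WV: "W ** V = mat 1" by blast
  then have VW: "V ** W = mat 1" by (simp add: matrix_left_right_inverse)
  define N where "N = V ** (M ** W)"
  have MW: "M ** W = W ** N" by (simp add: N_def matrix_mul_assoc WV)
  have Wb: "W *v axis b 1 = f b" for b by (simp add: W matrix_vector_mult_basis)
  have colN: "column b N = V *v (M *v f b)" for b
    by (simp only: N_def Wb[symmetric] matrix_vector_mult_basis[symmetric] matrix_vector_mul_assoc matrix_mul_assoc)
  have Vf: "V *v f b = axis b 1" for b
    by (simp only: Wb[symmetric] matrix_vector_mul_assoc VW matrix_vector_mul_lid)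
  have "[:-1, 1:] ^ 3 dvd charpoly N"
    by (rule cube_dvd_charpoly[of i j k])
      (use ijk neq Vf[of i] Vf[of j] Vf[of k] in \<open>auto simp: colN p q1 q2 matrix_vector_right_distrib\<close>)
  then have "[:-1, 1:] ^ 3 dvd charpoly M" using charpoly_similar[OF VW MW] by simp
  then have "3 \<le> order 1 (charpoly M)" using charpoly_nonzero[of M] by (simp add: order_divides)
  with ord show False by simp
qed

subsection \<open>Cubic expansions\<close>

text \<open>Coefficients carry no factorials, and the error o(\<open>\<xi>^3\<close>) is written
  with an explicit factor \<open>e\<close>, so that sums and products reduce to algebraic identities
  at nonzero \<xi> together with a limit. The value at 0 stays free because \<open>at 0\<close> is a
  punctured filter.\<close>

definition expands :: "(real \<Rightarrow> 'a::real_normed_vector) \<Rightarrow> 'a \<Rightarrow> 'a \<Rightarrow> 'a \<Rightarrow> 'a \<Rightarrow> bool" where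
  "expands f a b c d \<longleftrightarrow> (\<exists>e. (e \<longlongrightarrow> 0) (at 0) \<and>
     (\<forall>\<^sub>F \<xi> in at 0. f \<xi> = a + \<xi> *\<^sub>R b + \<xi>^2 *\<^sub>R c + \<xi>^3 *\<^sub>R (d + e \<xi>)))"

lemma expandsI:
  assumes "(e \<longlongrightarrow> 0) (at 0)" "\<And>\<xi>. \<xi> \<noteq> 0 \<Longrightarrow> f \<xi> = a + \<xi> *\<^sub>R b + \<xi>^2 *\<^sub>R c + \<xi>^3 *\<^sub>R (d + e \<xi>)"
  shows "expands f a b c d"
  unfolding expands_def using assms by (intro exI[of _ e]) (auto simp: eventually_at_filter)

lemma expandsE:
  assumes "expands f a b c d"
  obtains e where "(e \<longlongrightarrow> 0) (at 0)" "\<And>\<xi>. \<xi> \<noteq> 0 \<Longrightarrow> f \<xi> = a + \<xi> *\<^sub>R b + \<xi>^2 *\<^sub>R c + \<xi>^3 *\<^sub>R (d + e \<xi>)"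
proof -
  obtain e where e: "(e \<longlongrightarrow> 0) (at 0)" "\<forall>\<^sub>F \<xi> in at 0. f \<xi> = a + \<xi> *\<^sub>R b + \<xi>^2 *\<^sub>R c + \<xi>^3 *\<^sub>R (d + e \<xi>)"
    using assms unfolding expands_def by blast
  \<comment> \<open>Solving the identity for the error makes it hold at every nonzero \<xi>; near 0
    the result agrees with \<open>e\<close> and so has the same limit.\<close>
  define e' where "e' \<xi> = (1 / \<xi>^3) *\<^sub>R (f \<xi> - (a + \<xi> *\<^sub>R b + \<xi>^2 *\<^sub>R c)) - d" for \<xi>
  show ?thesis
  proof (rule that)
    have "\<forall>\<^sub>F \<xi> in at 0. e \<xi> = e' \<xi>"
      using e(2) eventually_neq_at_within[of 0 0 UNIV] by eventually_elim (simp add: e'_def)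
    then show "(e' \<longlongrightarrow> 0) (at 0)" using e(1) Lim_transform_eventually by blast
  qed (simp add: e'_def)
qed

lemma expands_cong:
  assumes "expands f a b c d" "\<forall>\<^sub>F \<xi> in at 0. f \<xi> = g \<xi>"
  shows "expands g a b c d"
proof -
  obtain e where e: "(e \<longlongrightarrow> 0) (at 0)" "\<forall>\<^sub>F \<xi> in at 0. f \<xi> = a + \<xi> *\<^sub>R b + \<xi>^2 *\<^sub>R c + \<xi>^3 *\<^sub>R (d + e \<xi>)"
    using assms unfolding expands_def by blast
  have "\<forall>\<^sub>F \<xi> in at 0. g \<xi> = a + \<xi> *\<^sub>R b + \<xi>^2 *\<^sub>R c + \<xi>^3 *\<^sub>R (d + e \<xi>)"
    using e(2) assms(2) by eventually_elim simp
  with e(1) show ?thesis unfolding expands_def by blast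
qed

lemma expands_poly: "expands (\<lambda>\<xi>. a + \<xi> *\<^sub>R b + \<xi>^2 *\<^sub>R c + \<xi>^3 *\<^sub>R d) a b c d"
  by (rule expandsI[of "\<lambda>_. 0"]) auto

lemma expands_add:
  assumes "expands f a b c d" "expands g a' b' c' d'"
  shows "expands (\<lambda>\<xi>. f \<xi> + g \<xi>) (a + a') (b + b') (c + c') (d + d')"
proof -
  obtain e where e: "(e \<longlongrightarrow> 0) (at 0)" "\<And>\<xi>. \<xi> \<noteq> 0 \<Longrightarrow> f \<xi> = a + \<xi> *\<^sub>R b + \<xi>^2 *\<^sub>R c + \<xi>^3 *\<^sub>R (d + e \<xi>)"
    using assms(1) by (rule expandsE) blast
  obtain e' where e': "(e' \<longlongrightarrow> 0) (at 0)" "\<And>\<xi>. \<xi> \<noteq> 0 \<Longrightarrow> g \<xi> = a' + \<xi> *\<^sub>R b' + \<xi>^2 *\<^sub>R c' + \<xi>^3 *\<^sub>R (d' + e' \<xi>)"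
    using assms(2) by (rule expandsE) blast
  show ?thesis
    by (rule expandsI[OF tendsto_add_zero[OF e(1) e'(1)]]) (simp add: e e' algebra_simps)
qed

lemma expands_tendsto:
  assumes "expands f a b c d"
  shows "(f \<longlongrightarrow> a) (at 0)"
proof -
  obtain e where e: "(e \<longlongrightarrow> 0) (at 0)" "\<And>\<xi>. \<xi> \<noteq> 0 \<Longrightarrow> f \<xi> = a + \<xi> *\<^sub>R b + \<xi>^2 *\<^sub>R c + \<xi>^3 *\<^sub>R (d + e \<xi>)"
    using assms by (rule expandsE) blast
  have "((\<lambda>\<xi>. a + \<xi> *\<^sub>R b + \<xi>^2 *\<^sub>R c + \<xi>^3 *\<^sub>R (d + e \<xi>)) \<longlongrightarrow>
      (a + 0 *\<^sub>R b + 0^2 *\<^sub>R c + 0^3 *\<^sub>R (d + 0))) (at 0)"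
    by (intro tendsto_intros e(1))
  then show ?thesis
    by (simp, elim Lim_transform_eventually) (auto simp: eventually_at_filter e(2))
qed

text \<open>Coefficients are peeled off from the lowest order. Once the lower ones vanish, dividing
  by a power of \<xi> leaves a polynomial equal to \<open>\<xi>^k *\<^sub>R - e \<xi>\<close>, which
  tends to 0, while the polynomial tends to the next coefficient; \<open>k\<close> drops from 3 to
  0.\<close>

lemma expands_zero_imp:
  fixes a :: "'a::real_normed_vector"
  assumes "expands (\<lambda>_. 0) a b c d"
  shows "a = 0 \<and> b = 0 \<and> c = 0 \<and> d = 0"
proof -
  obtain e where e: "(e \<longlongrightarrow> 0) (at 0)" "\<And>\<xi>. \<xi> \<noteq> 0 \<Longrightarrow> 0 = a + \<xi> *\<^sub>R b + \<xi>^2 *\<^sub>R c + \<xi>^3 *\<^sub>R (d + e \<xi>)"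
    using assms by (rule expandsE) blast
  let ?p = "\<lambda>\<xi>. - e \<xi>"
  have p: "(?p \<longlongrightarrow> 0) (at 0)" using tendsto_minus[OF e(1)] by simp
  have pe: "- (\<xi>^3 *\<^sub>R e \<xi>) = a + \<xi> *\<^sub>R b + \<xi>^2 *\<^sub>R c + \<xi>^3 *\<^sub>R d" if "\<xi> \<noteq> 0" for \<xi>
    using e(2)[OF that] by (metis add.assoc add_eq_0_iff2 scaleR_add_right)
  have unique: "x = 0" if "(g \<longlongrightarrow> x) (at (0::real))" "\<forall>\<^sub>F \<xi> in at 0. \<xi>^k *\<^sub>R ?p \<xi> = g \<xi>" for g and x :: 'a and k
  proof -
    have "((\<lambda>\<xi>. \<xi>^k *\<^sub>R ?p \<xi>) \<longlongrightarrow> 0^k *\<^sub>R 0) (at 0)" by (intro tendsto_intros p)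
    then have "(g \<longlongrightarrow> 0) (at 0)" using that(2) by (simp add: Lim_transform_eventually)
    with that(1) show ?thesis using tendsto_unique[of "at (0::real)"] by auto
  qed
  have a: "a = 0"
  proof (rule unique[where k=3])
    show "((\<lambda>\<xi>::real. a + \<xi> *\<^sub>R b + \<xi>^2 *\<^sub>R c + \<xi>^3 *\<^sub>R d) \<longlongrightarrow> a) (at 0)"
      by (auto intro!: tendsto_eq_intros)
  qed (auto simp: eventually_at_filter pe)
  have b: "b = 0"
  proof (rule unique[where k=2])
    show "((\<lambda>\<xi>::real. b + \<xi> *\<^sub>R c + \<xi>^2 *\<^sub>R d) \<longlongrightarrow> b) (at 0)"
      by (auto intro!: tendsto_eq_intros)
    have "\<xi>^2 *\<^sub>R - e \<xi> = b + \<xi> *\<^sub>R c + \<xi>^2 *\<^sub>R d" if "\<xi> \<noteq> 0" for \<xi>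
    proof -
      have "\<xi> *\<^sub>R (\<xi>^2 *\<^sub>R - e \<xi>) = \<xi> *\<^sub>R (b + \<xi> *\<^sub>R c + \<xi>^2 *\<^sub>R d)"
        using pe[OF that] by (simp add: a power2_eq_square power3_eq_cube scaleR_add_right mult.assoc)
      then show ?thesis using that by (simp only: scaleR_cancel_left) simp
    qed
    then show "\<forall>\<^sub>F \<xi> in at 0. \<xi>^2 *\<^sub>R - e \<xi> = b + \<xi> *\<^sub>R c + \<xi>^2 *\<^sub>R d" by (auto simp: eventually_at_filter)
  qed
  have c: "c = 0"
  proof (rule unique[where k=1])
    show "((\<lambda>\<xi>::real. c + \<xi> *\<^sub>R d) \<longlongrightarrow> c) (at 0)"
      by (auto intro!: tendsto_eq_intros)
    have "\<xi>^1 *\<^sub>R - e \<xi> = c + \<xi> *\<^sub>R d" if "\<xi> \<noteq> 0" for \<xi>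
    proof -
      have "\<xi>^2 *\<^sub>R (\<xi>^1 *\<^sub>R - e \<xi>) = \<xi>^2 *\<^sub>R (c + \<xi> *\<^sub>R d)"
        using pe[OF that] by (simp add: a b power2_eq_square power3_eq_cube scaleR_add_right mult.assoc)
      then show ?thesis using that by (simp only: scaleR_cancel_left) simp
    qed
    then show "\<forall>\<^sub>F \<xi> in at 0. \<xi>^1 *\<^sub>R - e \<xi> = c + \<xi> *\<^sub>R d" by (auto simp: eventually_at_filter)
  qed
  have d: "d = 0"
  proof (rule unique[where k=0])
    show "((\<lambda>\<xi>::real. d) \<longlongrightarrow> d) (at 0)" by simp
    have "- e \<xi> = d" if "\<xi> \<noteq> 0" for \<xi>
      using pe[OF that] that a b c by (simp flip: scaleR_minus_right)
    then show "\<forall>\<^sub>F \<xi> in at 0. \<xi>^0 *\<^sub>R - e \<xi> = d" by (auto simp: eventually_at_filter)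
  qed
  from a b c d show ?thesis by simp
qed

lemma expands_scaleR:
  fixes p :: "real \<Rightarrow> real"
  assumes p: "expands p p0 p1 p2 p3" and f: "expands f a b c d"
  shows "expands (\<lambda>\<xi>. p \<xi> *\<^sub>R f \<xi>) (p0 *\<^sub>R a) (p0 *\<^sub>R b + p1 *\<^sub>R a) (p0 *\<^sub>R c + p1 *\<^sub>R b + p2 *\<^sub>R a)
           (p0 *\<^sub>R d + p1 *\<^sub>R c + p2 *\<^sub>R b + p3 *\<^sub>R a)"
proof -
  obtain e where e: "(e \<longlongrightarrow> 0) (at 0)" "\<And>\<xi>. \<xi> \<noteq> 0 \<Longrightarrow> f \<xi> = a + \<xi> *\<^sub>R b + \<xi>^2 *\<^sub>R c + \<xi>^3 *\<^sub>R (d + e \<xi>)"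
    using f by (rule expandsE) blast
  obtain q where q: "(q \<longlongrightarrow> 0) (at 0)" "\<And>\<xi>. \<xi> \<noteq> 0 \<Longrightarrow> p \<xi> = p0 + \<xi> *\<^sub>R p1 + \<xi>^2 *\<^sub>R p2 + \<xi>^3 *\<^sub>R (p3 + q \<xi>)"
    using p by (rule expandsE) blast
  let ?p = "\<lambda>\<xi>. p0 + \<xi> * p1 + \<xi>^2 * p2 + \<xi>^3 * p3"
  \<comment> \<open>The terms of degree 4 to 6 in the product of the two cubic polynomials, divided
    by \<open>\<xi>^4\<close>.\<close>
  let ?e = "\<lambda>\<xi>. p1 *\<^sub>R d + p2 *\<^sub>R c + p3 *\<^sub>R b + \<xi> *\<^sub>R (p2 *\<^sub>R d + p3 *\<^sub>R c) + \<xi>^2 *\<^sub>R (p3 *\<^sub>R d)"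
  have "((\<lambda>\<xi>. q \<xi> *\<^sub>R f \<xi> + ?p \<xi> *\<^sub>R e \<xi> + \<xi> *\<^sub>R ?e \<xi>) \<longlongrightarrow> 0 *\<^sub>R a + ?p 0 *\<^sub>R 0 + 0 *\<^sub>R ?e 0) (at 0)"
    by (intro tendsto_intros expands_tendsto[OF f] e(1) q(1))
  then have "((\<lambda>\<xi>. q \<xi> *\<^sub>R f \<xi> + ?p \<xi> *\<^sub>R e \<xi> + \<xi> *\<^sub>R ?e \<xi>) \<longlongrightarrow> 0) (at 0)" by simp
  then show ?thesis
    by (rule expandsI) (simp add: e(2) q(2) algebra_simps power2_eq_square power3_eq_cube)
qed

lemma expands_unique:
  assumes "expands f a b c d" "expands f a' b' c' d'"
  shows "a = a' \<and> b = b' \<and> c = c' \<and> d = d'"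
  using expands_zero_imp[of "a - a'" "b - b'" "c - c'" "d - d'"]
    expands_add[OF assms(1) expands_scaleR[OF expands_poly[of "-1" 0 0 0] assms(2)]]
  by simp

lemma expands_bigo:
  assumes "(\<lambda>\<xi>. norm (f \<xi> - (a + \<xi> *\<^sub>R b + \<xi>^2 *\<^sub>R c + \<xi>^3 *\<^sub>R d))) \<in> O[at 0](\<lambda>\<xi>::real. \<xi>^4)"
  shows "expands f a b c d"
proof -
  let ?r = "\<lambda>\<xi>. f \<xi> - (a + \<xi> *\<^sub>R b + \<xi>^2 *\<^sub>R c + \<xi>^3 *\<^sub>R d)"
  obtain C where C: "\<forall>\<^sub>F \<xi> in at 0. norm (norm (?r \<xi>)) \<le> C * norm (\<xi>^4)"
    using landau_o.bigE[OF assms] by blast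
  have "((\<lambda>\<xi>. (1 / \<xi>^3) *\<^sub>R ?r \<xi>) \<longlongrightarrow> 0) (at 0)"
  proof (rule Lim_null_comparison)
    show "((\<lambda>\<xi>::real. C * \<bar>\<xi>\<bar>) \<longlongrightarrow> 0) (at 0)" by (auto intro!: tendsto_eq_intros)
    show "\<forall>\<^sub>F \<xi> in at 0. norm ((1 / \<xi>^3) *\<^sub>R ?r \<xi>) \<le> C * \<bar>\<xi>\<bar>"
      using C eventually_neq_at_within[of 0 0 UNIV]
    proof eventually_elim
      case (elim \<xi>)
      have "norm ((1 / \<xi>^3) *\<^sub>R ?r \<xi>) = norm (?r \<xi>) / \<bar>\<xi>\<bar>^3" by (simp add: power_abs divide_inverse)
      also have "\<dots> \<le> C * \<bar>\<xi>\<bar>^4 / \<bar>\<xi>\<bar>^3" using elim by (intro divide_right_mono) (auto simp: power_abs)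
      also have "\<dots> = C * \<bar>\<xi>\<bar>" using elim by (simp add: power_Suc[of _ 3, simplified])
      finally show ?case .
    qed
  qed
  then show ?thesis by (rule expandsI) (simp add: scaleR_add_right)
qed


section \<open>Taylor expansion with a remainder uniform in a parameter\<close>

text \<open>One integration of a bound, by the mean value inequality. The gain
  \<open>1 / (n + 1)\<close> is given away, as \<epsilon> is arbitrary in the applications.\<close>

lemma norm_le_power_Suc_of_derivative:
  fixes w :: "real \<Rightarrow> 'b::real_normed_vector"
  assumes der: "\<And>\<eta>. \<bar>\<eta>\<bar> < d \<Longrightarrow> (w has_vector_derivative w' \<eta>) (at \<eta>)" and "w 0 = 0"
    and bd: "\<And>\<eta>. \<bar>\<eta>\<bar> < d \<Longrightarrow> norm (w' \<eta>) \<le> \<epsilon> * \<bar>\<eta>\<bar>^n" and \<xi>: "\<bar>\<xi>\<bar> < d" and "0 \<le> \<epsilon>"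
  shows "norm (w \<xi>) \<le> \<epsilon> * \<bar>\<xi>\<bar>^Suc n"
proof -
  have "norm (w \<xi> - w 0) \<le> (\<epsilon> * \<bar>\<xi>\<bar>^n) * norm (\<xi> - 0)"
  proof (rule differentiable_bound[where S="{-\<bar>\<xi>\<bar>..\<bar>\<xi>\<bar>}" and f'="\<lambda>\<eta> h. h *\<^sub>R w' \<eta>"])
    fix \<eta> assume \<eta>: "\<eta> \<in> {-\<bar>\<xi>\<bar>..\<bar>\<xi>\<bar>}"
    then have "\<bar>\<eta>\<bar> < d" "\<bar>\<eta>\<bar> \<le> \<bar>\<xi>\<bar>" using \<xi> by auto
    then show "(w has_derivative (\<lambda>h. h *\<^sub>R w' \<eta>)) (at \<eta> within {-\<bar>\<xi>\<bar>..\<bar>\<xi>\<bar>})"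
      using der[of \<eta>] has_derivative_at_withinI unfolding has_vector_derivative_def by blast
    have "norm (w' \<eta>) \<le> \<epsilon> * \<bar>\<xi>\<bar>^n"
      using bd[OF \<open>\<bar>\<eta>\<bar> < d\<close>] mult_left_mono[OF power_mono[OF \<open>\<bar>\<eta>\<bar> \<le> \<bar>\<xi>\<bar>\<close>] \<open>0 \<le> \<epsilon>\<close>, of n] by simp
    then show "onorm (\<lambda>h. h *\<^sub>R w' \<eta>) \<le> \<epsilon> * \<bar>\<xi>\<bar>^n"
      by (intro onorm_bound) (auto simp: \<open>0 \<le> \<epsilon>\<close> mult.commute mult_left_mono)
  qed auto
  then show ?thesis by (simp add: \<open>w 0 = 0\<close> mult_ac)
qed

text \<open>Uniform continuity of \<open>g3\<close> on a compact strip makes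
  \<open>g3 s \<eta> - g3 s 0\<close> small uniformly in \<open>s\<close>, and three integrations in
  \<xi> carry this over to \<open>g\<close>. Uniformity in \<open>s\<close> is what allows the
  remainder to be integrated over \<open>s\<close> later.\<close>

lemma uniform_taylor3:
  fixes g g1 g2 g3 :: "'s::metric_space \<Rightarrow> real \<Rightarrow> 'b::real_normed_vector"
  assumes A: "compact A" and \<delta>: "0 < \<delta>"
    and g: "\<And>s \<xi>. s \<in> A \<Longrightarrow> \<bar>\<xi>\<bar> < \<delta> \<Longrightarrow> (g s has_vector_derivative g1 s \<xi>) (at \<xi>)"
    and g1: "\<And>s \<xi>. s \<in> A \<Longrightarrow> \<bar>\<xi>\<bar> < \<delta> \<Longrightarrow> (g1 s has_vector_derivative g2 s \<xi>) (at \<xi>)"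
    and g2: "\<And>s \<xi>. s \<in> A \<Longrightarrow> \<bar>\<xi>\<bar> < \<delta> \<Longrightarrow> (g2 s has_vector_derivative g3 s \<xi>) (at \<xi>)"
    and g3: "continuous_on (A \<times> {-\<delta><..<\<delta>}) (\<lambda>(s, \<xi>). g3 s \<xi>)"
    and \<epsilon>: "0 < \<epsilon>"
  obtains d where "0 < d" "d \<le> \<delta>"
    "\<And>s \<xi>. s \<in> A \<Longrightarrow> \<bar>\<xi>\<bar> < d \<Longrightarrow>
       norm (g s \<xi> - (g s 0 + \<xi> *\<^sub>R g1 s 0 + \<xi>^2 *\<^sub>R ((1/2) *\<^sub>R g2 s 0) + \<xi>^3 *\<^sub>R ((1/6) *\<^sub>R g3 s 0))) \<le> \<epsilon> * \<bar>\<xi>\<bar>^3"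
proof -
  let ?K = "A \<times> {-(\<delta>/2)..\<delta>/2}"
  have "uniformly_continuous_on ?K (\<lambda>(s, \<xi>). g3 s \<xi>)"
    by (rule compact_uniformly_continuous[OF continuous_on_subset[OF g3]])
      (use A \<delta> in \<open>auto intro: compact_Times\<close>)
  then obtain d0 where d0: "0 < d0" "\<And>p q. p \<in> ?K \<Longrightarrow> q \<in> ?K \<Longrightarrow> dist q p < d0 \<Longrightarrow>
      dist (case q of (s, \<xi>) \<Rightarrow> g3 s \<xi>) (case p of (s, \<xi>) \<Rightarrow> g3 s \<xi>) < \<epsilon>"
    using \<epsilon> unfolding uniformly_continuous_on_def by metis
  define d where "d = min d0 (\<delta>/2)"
  have d: "0 < d" "d \<le> d0" "d \<le> \<delta>/2" using d0 \<delta> by (auto simp: d_def)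
  show ?thesis
  proof (rule that[OF d(1)])
    fix s \<xi> assume s: "s \<in> A" and \<xi>: "\<bar>\<xi>\<bar> < (d::real)"
    have lt: "\<bar>\<eta>\<bar> < \<delta>" if "\<bar>\<eta>\<bar> < d" for \<eta> using d \<delta> that by linarith
    have b3: "norm (g3 s \<eta> - g3 s 0) \<le> \<epsilon> * \<bar>\<eta>\<bar>^0" if "\<bar>\<eta>\<bar> < d" for \<eta>
    proof -
      have "- (\<delta>/2) \<le> \<eta>" "\<eta> \<le> \<delta>/2" "\<bar>\<eta>\<bar> < d0" using that d by linarith+
      then show ?thesis using d0(2)[of "(s, 0)" "(s, \<eta>)"] s \<delta> by (auto simp: dist_norm dist_Pair_Pair)
    qed
    have b2: "norm (g2 s \<eta> - (g2 s 0 + \<eta> *\<^sub>R g3 s 0)) \<le> \<epsilon> * \<bar>\<eta>\<bar>^Suc 0" if "\<bar>\<eta>\<bar> < d" for \<eta>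
      by (rule norm_le_power_Suc_of_derivative[where d=d and w'="\<lambda>\<eta>. g3 s \<eta> - g3 s 0", OF _ _ b3 that])
        (use \<epsilon> in \<open>auto intro!: derivative_eq_intros g2 s lt\<close>)
    have b1: "norm (g1 s \<eta> - (g1 s 0 + \<eta> *\<^sub>R g2 s 0 + (\<eta>^2/2) *\<^sub>R g3 s 0)) \<le> \<epsilon> * \<bar>\<eta>\<bar>^Suc (Suc 0)" if "\<bar>\<eta>\<bar> < d" for \<eta>
      by (rule norm_le_power_Suc_of_derivative[where d=d and w'="\<lambda>\<eta>. g2 s \<eta> - (g2 s 0 + \<eta> *\<^sub>R g3 s 0)", OF _ _ b2 that])
        (use \<epsilon> in \<open>auto intro!: derivative_eq_intros g1 s lt\<close>)
    have b0: "norm (g s \<eta> - (g s 0 + \<eta> *\<^sub>R g1 s 0 + (\<eta>^2/2) *\<^sub>R g2 s 0 + (\<eta>^3/6) *\<^sub>R g3 s 0)) \<le> \<epsilon> * \<bar>\<eta>\<bar>^Suc (Suc (Suc 0))" if "\<bar>\<eta>\<bar> < d" for \<eta>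
      by (rule norm_le_power_Suc_of_derivative[where d=d and w'="\<lambda>\<eta>. g1 s \<eta> - (g1 s 0 + \<eta> *\<^sub>R g2 s 0 + (\<eta>^2/2) *\<^sub>R g3 s 0)", OF _ _ b1 that])
        (use \<epsilon> in \<open>auto intro!: derivative_eq_intros g s lt\<close>)
    show "norm (g s \<xi> - (g s 0 + \<xi> *\<^sub>R g1 s 0 + \<xi>^2 *\<^sub>R ((1/2) *\<^sub>R g2 s 0) + \<xi>^3 *\<^sub>R ((1/6) *\<^sub>R g3 s 0))) \<le> \<epsilon> * \<bar>\<xi>\<bar>^3"
      using b0[OF \<xi>] by (simp add: numeral_3_eq_3)
  qed (use d \<delta> in auto)
qed

lemma expands_taylor_bound:
  assumes "\<And>\<epsilon>. 0 < \<epsilon> \<Longrightarrow> \<exists>\<delta>>0. \<forall>\<xi>. \<bar>\<xi>\<bar> < \<delta> \<longrightarrow>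
       norm (f \<xi> - (a + \<xi> *\<^sub>R b + \<xi>^2 *\<^sub>R c + \<xi>^3 *\<^sub>R d)) \<le> \<epsilon> * \<bar>\<xi>\<bar>^3"
  shows "expands f a b c d"
proof (rule expandsI)
  let ?e = "\<lambda>\<xi>. (1 / \<xi>^3) *\<^sub>R (f \<xi> - (a + \<xi> *\<^sub>R b + \<xi>^2 *\<^sub>R c + \<xi>^3 *\<^sub>R d))"
  show "(?e \<longlongrightarrow> 0) (at 0)"
  proof (rule LIM_I)
    fix r :: real assume "0 < r"
    then obtain \<delta> where \<delta>: "0 < \<delta>" "\<And>\<xi>. \<bar>\<xi>\<bar> < \<delta> \<Longrightarrow>
       norm (f \<xi> - (a + \<xi> *\<^sub>R b + \<xi>^2 *\<^sub>R c + \<xi>^3 *\<^sub>R d)) \<le> (r/2) * \<bar>\<xi>\<bar>^3"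
      using assms[of "r/2"] by (metis half_gt_zero)
    have "norm (?e \<xi> - 0) < r" if "\<xi> \<noteq> 0" "norm (\<xi> - 0) < \<delta>" for \<xi>
    proof -
      have "norm (?e \<xi>) = norm (f \<xi> - (a + \<xi> *\<^sub>R b + \<xi>^2 *\<^sub>R c + \<xi>^3 *\<^sub>R d)) / \<bar>\<xi>\<bar>^3"
        by (simp add: power_abs divide_inverse)
      also have "\<dots> \<le> (r/2) * \<bar>\<xi>\<bar>^3 / \<bar>\<xi>\<bar>^3" using \<delta>(2)[of \<xi>] that by (intro divide_right_mono) auto
      also have "\<dots> < r" using \<open>0 < r\<close> that by simp
      finally show ?thesis by simp
    qed
    with \<delta>(1) show "\<exists>s>0. \<forall>x. x \<noteq> 0 \<and> norm (x - 0) < s \<longrightarrow> norm (?e x - 0) < r" by blast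
  qed
qed (simp add: scaleR_add_right)

lemma expands_taylor:
  fixes g g1 g2 g3 :: "real \<Rightarrow> 'b::real_normed_vector"
  assumes \<delta>: "0 < \<delta>" and g: "\<And>\<xi>. \<bar>\<xi>\<bar> < \<delta> \<Longrightarrow> (g has_vector_derivative g1 \<xi>) (at \<xi>)"
    "\<And>\<xi>. \<bar>\<xi>\<bar> < \<delta> \<Longrightarrow> (g1 has_vector_derivative g2 \<xi>) (at \<xi>)"
    "\<And>\<xi>. \<bar>\<xi>\<bar> < \<delta> \<Longrightarrow> (g2 has_vector_derivative g3 \<xi>) (at \<xi>)"
    and g3: "continuous_on {-\<delta><..<\<delta>} g3"
  shows "expands g (g 0) (g1 0) ((1/2) *\<^sub>R g2 0) ((1/6) *\<^sub>R g3 0)"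
proof (rule expands_taylor_bound)
  fix \<epsilon> :: real assume \<epsilon>: "0 < \<epsilon>"
  \<comment> \<open>A one-point parameter set reduces the uniform statement to a single
    function.\<close>
  have cont: "continuous_on ({0::real} \<times> {-\<delta><..<\<delta>}) (\<lambda>(s, \<xi>). g3 \<xi>)"
    unfolding case_prod_beta by (rule continuous_on_compose2[OF g3]) (auto intro!: continuous_intros)
  obtain d where "0 < d" "\<And>s \<xi>. s \<in> {0::real} \<Longrightarrow> \<bar>\<xi>\<bar> < d \<Longrightarrow>
       norm (g \<xi> - (g 0 + \<xi> *\<^sub>R g1 0 + \<xi>^2 *\<^sub>R ((1/2) *\<^sub>R g2 0) + \<xi>^3 *\<^sub>R ((1/6) *\<^sub>R g3 0))) \<le> \<epsilon> * \<bar>\<xi>\<bar>^3"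
    by (rule uniform_taylor3[of "{0::real}" \<delta> "\<lambda>_. g" "\<lambda>_. g1" "\<lambda>_. g2" "\<lambda>_. g3" \<epsilon>, OF compact_sing \<delta> g cont \<epsilon>]) blast+
  then show "\<exists>\<delta>>0. \<forall>\<xi>. \<bar>\<xi>\<bar> < \<delta> \<longrightarrow>
       norm (g \<xi> - (g 0 + \<xi> *\<^sub>R g1 0 + \<xi>^2 *\<^sub>R ((1/2) *\<^sub>R g2 0) + \<xi>^3 *\<^sub>R ((1/6) *\<^sub>R g3 0))) \<le> \<epsilon> * \<bar>\<xi>\<bar>^3"
    by blast
qed

lemma has_vector_derivative_of_integral_eq:
  fixes f k :: "real \<Rightarrow> 'b::banach"
  assumes k: "continuous_on UNIV k" and f: "\<And>a b. a \<le> b \<Longrightarrow> f b - f a = integral {a..b} k"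
  shows "(f has_vector_derivative k t) (at t)"
proof -
  have "((\<lambda>u. f (t - 1) + integral {t-1..u} k) has_vector_derivative k t) (at t within {t-1..t+1})"
    using integral_has_vector_derivative[OF continuous_on_subset[OF k subset_UNIV], of t "t-1" "t+1"]
    by (auto intro!: derivative_eq_intros)
  then have "((\<lambda>u. f (t - 1) + integral {t-1..u} k) has_vector_derivative k t) (at t)"
    by (simp add: at_within_Icc_at)
  then show ?thesis
  proof (rule has_vector_derivative_transform_within_open[where S="{t-1<..<t+1}"])
    fix u assume "u \<in> {t-1<..<t+1}"
    then show "f (t - 1) + integral {t-1..u} k = f u" using f[of "t-1" u] by (simp add: diff_eq_eq add.commute)
  qed auto
qed

text \<open>\<open>H b \<xi> - H a \<xi>\<close> has two expansions: the difference of the given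
  ones, and the integral over \<open>{a..b}\<close> of the uniform Taylor expansion of
  \<open>K\<close>. Uniqueness of coefficients turns the increments of \<open>c0\<close> to
  \<open>c3\<close> into integrals of continuous functions.\<close>

lemma expansion_coefficients_derivative:
  fixes H K K1 K2 K3 :: "real \<Rightarrow> real \<Rightarrow> 'b::banach"
  assumes \<delta>: "0 < \<delta>"
    and H: "\<And>\<tau> \<xi>. \<bar>\<xi>\<bar> < \<delta> \<Longrightarrow> ((\<lambda>\<tau>. H \<tau> \<xi>) has_vector_derivative K \<tau> \<xi>) (at \<tau>)"
    and K: "\<And>\<tau> \<xi>. \<bar>\<xi>\<bar> < \<delta> \<Longrightarrow> (K \<tau> has_vector_derivative K1 \<tau> \<xi>) (at \<xi>)"
    and K1: "\<And>\<tau> \<xi>. \<bar>\<xi>\<bar> < \<delta> \<Longrightarrow> (K1 \<tau> has_vector_derivative K2 \<tau> \<xi>) (at \<xi>)"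
    and K2: "\<And>\<tau> \<xi>. \<bar>\<xi>\<bar> < \<delta> \<Longrightarrow> (K2 \<tau> has_vector_derivative K3 \<tau> \<xi>) (at \<xi>)"
    and K3: "continuous_on (UNIV \<times> {-\<delta><..<\<delta>}) (\<lambda>(\<tau>, \<xi>). K3 \<tau> \<xi>)"
    and cont: "continuous_on UNIV (\<lambda>\<tau>. K \<tau> 0)" "continuous_on UNIV (\<lambda>\<tau>. K1 \<tau> 0)"
      "continuous_on UNIV (\<lambda>\<tau>. K2 \<tau> 0)"
    and ex: "\<And>\<tau>. expands (H \<tau>) (c0 \<tau>) (c1 \<tau>) (c2 \<tau>) (c3 \<tau>)"
  shows "(c0 has_vector_derivative K \<tau> 0) (at \<tau>)" "(c1 has_vector_derivative K1 \<tau> 0) (at \<tau>)"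
    "(c2 has_vector_derivative (1/2) *\<^sub>R K2 \<tau> 0) (at \<tau>)" "(c3 has_vector_derivative (1/6) *\<^sub>R K3 \<tau> 0) (at \<tau>)"
proof -
  have cont3: "continuous_on UNIV (\<lambda>\<tau>. K3 \<tau> 0)"
    using continuous_on_compose2[OF K3, of UNIV "\<lambda>\<tau>. (\<tau>, 0)"] \<delta>
    by (auto simp: continuous_on_Pair continuous_on_id continuous_on_const image_subset_iff)
  note sub = continuous_on_subset[OF _ subset_UNIV]
  have coeffs: "c0 b - c0 a = integral {a..b} (\<lambda>\<tau>. K \<tau> 0) \<and> c1 b - c1 a = integral {a..b} (\<lambda>\<tau>. K1 \<tau> 0) \<and>
      c2 b - c2 a = integral {a..b} (\<lambda>\<tau>. (1/2) *\<^sub>R K2 \<tau> 0) \<and> c3 b - c3 a = integral {a..b} (\<lambda>\<tau>. (1/6) *\<^sub>R K3 \<tau> 0)"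
    if ab: "a \<le> b" for a b
  proof (rule expands_unique)
    show "expands (\<lambda>\<xi>. H b \<xi> - H a \<xi>) (c0 b - c0 a) (c1 b - c1 a) (c2 b - c2 a) (c3 b - c3 a)"
      using expands_add[OF ex[of b] expands_scaleR[OF expands_poly[of "-1" 0 0 0] ex[of a]]] by simp
    let ?T = "\<lambda>\<tau> \<xi>. K \<tau> 0 + \<xi> *\<^sub>R K1 \<tau> 0 + \<xi>^2 *\<^sub>R ((1/2) *\<^sub>R K2 \<tau> 0) + \<xi>^3 *\<^sub>R ((1/6) *\<^sub>R K3 \<tau> 0)"
    let ?I = "\<lambda>\<xi>. integral {a..b} (\<lambda>\<tau>. K \<tau> 0) + \<xi> *\<^sub>R integral {a..b} (\<lambda>\<tau>. K1 \<tau> 0)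
      + \<xi>^2 *\<^sub>R integral {a..b} (\<lambda>\<tau>. (1/2) *\<^sub>R K2 \<tau> 0) + \<xi>^3 *\<^sub>R integral {a..b} (\<lambda>\<tau>. (1/6) *\<^sub>R K3 \<tau> 0)"
    show "expands (\<lambda>\<xi>. H b \<xi> - H a \<xi>) (integral {a..b} (\<lambda>\<tau>. K \<tau> 0)) (integral {a..b} (\<lambda>\<tau>. K1 \<tau> 0))
       (integral {a..b} (\<lambda>\<tau>. (1/2) *\<^sub>R K2 \<tau> 0)) (integral {a..b} (\<lambda>\<tau>. (1/6) *\<^sub>R K3 \<tau> 0))"
    proof (rule expands_taylor_bound)
      fix \<epsilon> :: real assume \<epsilon>: "0 < \<epsilon>"
      \<comment> \<open>Integrating over \<open>{a..b}\<close> costs the factor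
        \<open>b - a\<close>; the added 1 keeps the quotient meaningful when
        \<open>a = b\<close>.\<close>
      define \<epsilon>' where "\<epsilon>' = \<epsilon> / (b - a + 1)"
      have \<epsilon>': "0 < \<epsilon>'" "\<epsilon>' * (b - a) \<le> \<epsilon>" using \<epsilon> ab by (auto simp: \<epsilon>'_def field_simps)
      obtain d where d: "0 < d" "d \<le> \<delta>" and bd: "\<And>s \<xi>. s \<in> {a..b} \<Longrightarrow> \<bar>\<xi>\<bar> < d \<Longrightarrow> norm (K s \<xi> - ?T s \<xi>) \<le> \<epsilon>' * \<bar>\<xi>\<bar>^3"
        by (rule uniform_taylor3[of "{a..b}" \<delta> K K1 K2 K3 \<epsilon>'])
          (use \<delta> K K1 K2 \<epsilon>' in \<open>auto intro: continuous_on_subset[OF K3]\<close>)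
      have "norm ((H b \<xi> - H a \<xi>) - ?I \<xi>) \<le> \<epsilon> * \<bar>\<xi>\<bar>^3" if \<xi>: "\<bar>\<xi>\<bar> < d" for \<xi>
      proof -
        have "((\<lambda>s. K s \<xi>) has_integral (H b \<xi> - H a \<xi>)) {a..b}"
          by (rule fundamental_theorem_of_calculus[OF ab])
            (use \<xi> d in \<open>auto intro!: has_vector_derivative_at_within H\<close>)
        moreover have "((\<lambda>s. ?T s \<xi>) has_integral ?I \<xi>) {a..b}"
          by (intro has_integral_add has_integral_cmul integrable_integral integrable_continuous_interval
              continuous_intros sub[OF cont(1)] sub[OF cont(2)] sub[OF cont(3)] sub[OF cont3])
        ultimately have "((\<lambda>s. K s \<xi> - ?T s \<xi>) has_integral ((H b \<xi> - H a \<xi>) - ?I \<xi>)) {a..b}"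
          by (rule has_integral_diff)
        then have "norm ((H b \<xi> - H a \<xi>) - ?I \<xi>) \<le> (\<epsilon>' * \<bar>\<xi>\<bar>^3) * measure lborel {a..b}"
          by (intro has_integral_bound_real[where f="\<lambda>s. K s \<xi> - ?T s \<xi>"]) (use \<epsilon>' bd \<xi> in auto)
        also have "\<dots> = (\<epsilon>' * (b - a)) * \<bar>\<xi>\<bar>^3" using ab by simp
        also have "\<dots> \<le> \<epsilon> * \<bar>\<xi>\<bar>^3" using \<epsilon>' by (intro mult_right_mono) auto
        finally show ?thesis .
      qed
      with d show "\<exists>d>0. \<forall>\<xi>. \<bar>\<xi>\<bar> < d \<longrightarrow> norm ((H b \<xi> - H a \<xi>) - ?I \<xi>) \<le> \<epsilon> * \<bar>\<xi>\<bar>^3" by blast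
    qed
  qed
  show "(c0 has_vector_derivative K \<tau> 0) (at \<tau>)" "(c1 has_vector_derivative K1 \<tau> 0) (at \<tau>)"
    "(c2 has_vector_derivative (1/2) *\<^sub>R K2 \<tau> 0) (at \<tau>)" "(c3 has_vector_derivative (1/6) *\<^sub>R K3 \<tau> 0) (at \<tau>)"
    by (rule has_vector_derivative_of_integral_eq[of "\<lambda>\<tau>. K \<tau> 0"]
        has_vector_derivative_of_integral_eq[of "\<lambda>\<tau>. K1 \<tau> 0"]
        has_vector_derivative_of_integral_eq[of "\<lambda>\<tau>. (1/2) *\<^sub>R K2 \<tau> 0"]
        has_vector_derivative_of_integral_eq[of "\<lambda>\<tau>. (1/6) *\<^sub>R K3 \<tau> 0"],
        use coeffs in \<open>auto intro!: continuous_intros cont cont3\<close>)+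
qed

subsection \<open>Expansion along a C3 map\<close>

lemma Ck_on_Suc_has_derivative:
  assumes "Ck_on (Suc k) S f" "x \<in> S"
  shows "(f has_derivative frechet_derivative f (at x)) (at x)"
  using assms by (simp add: frechet_derivative_works[symmetric])

lemma Ck_on_mono: "Ck_on (Suc k) S f \<Longrightarrow> Ck_on k S f"
proof (induction k arbitrary: f)
  case 0
  then show ?case
    by (auto simp: continuous_at_imp_continuous_on differentiable_imp_continuous_within)
next
  case (Suc k)
  from Suc.prems have "\<forall>x\<in>S. f differentiable (at x)" "\<And>w. Ck_on (Suc k) S (\<lambda>x. frechet_derivative f (at x) w)"
    by (subst (asm) Ck_on.simps(2), blast)+
  then show ?case using Suc.IH by (subst Ck_on.simps(2)) blast
qed

lemma Ck_on_le: "Ck_on m S f \<Longrightarrow> k \<le> m \<Longrightarrow> Ck_on k S f"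
  by (induction m) (auto simp: le_Suc_eq simp del: Ck_on.simps dest: Ck_on_mono)

lemma D1_has_derivative:
  assumes "Ck_on (Suc k) UNIV F"
  shows "(F has_derivative D1 F x) (at x)"
  using Ck_on_Suc_has_derivative[OF assms UNIV_I] by (simp add: D1_def[abs_def])

lemma D1_linear:
  assumes "Ck_on (Suc k) UNIV F"
  shows "linear (D1 F x)"
  using D1_has_derivative[OF assms] has_derivative_linear by blast

lemma D1_Ck:
  assumes "Ck_on (Suc k) UNIV F"
  shows "Ck_on k UNIV (\<lambda>x. D1 F x w)"
  using assms by (simp add: D1_def)

lemma D2_eq_D1: "D2 F x w1 w2 = D1 (\<lambda>y. D1 F y w1) x w2"
  by (simp add: D2_def D1_def)

lemma D3_eq_D1: "D3 F x w1 w2 w3 = D1 (\<lambda>y. D1 (\<lambda>z. D1 F z w1) y w2) x w3"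
  by (simp add: D3_def D2_def D1_def)

text \<open>The first direction sits inside the function being differentiated, so linearity in it is
  inherited from \<open>D1 F y\<close> by uniqueness of the derivative. It later lets the factor 1/2
  of \<open>h2\<close> pass through \<open>D2\<close>.\<close>

lemma D2_linear_left:
  assumes "Ck_on 2 UNIV F"
  shows "linear (\<lambda>w. D2 F x w w2)"
proof -
  have C: "Ck_on (Suc (Suc 0)) UNIV F" using assms by (simp add: numeral_2_eq_2 del: Ck_on.simps)
  note lin = D1_linear[OF C]
  note der = D1_has_derivative[OF D1_Ck[OF C]]
  show ?thesis
  proof (rule linearI)
    fix u w
    have "((\<lambda>y. D1 F y (u + w)) has_derivative (\<lambda>h. D1 (\<lambda>y. D1 F y u) x h + D1 (\<lambda>y. D1 F y w) x h)) (at x)"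
      by (simp only: linear_add[OF lin]) (intro has_derivative_add der)
    from fun_cong[OF has_derivative_unique[OF this der], of w2]
    show "D2 F x (u + w) w2 = D2 F x u w2 + D2 F x w w2" by (simp add: D2_eq_D1)
  next
    fix r u
    have "((\<lambda>y. D1 F y (r *\<^sub>R u)) has_derivative (\<lambda>h. r *\<^sub>R D1 (\<lambda>y. D1 F y u) x h)) (at x)"
      by (simp only: linear_cmul[OF lin]) (intro has_derivative_scaleR_right der)
    from fun_cong[OF has_derivative_unique[OF this der], of w2]
    show "D2 F x (r *\<^sub>R u) w2 = r *\<^sub>R D2 F x u w2" by (simp add: D2_eq_D1)
  qed
qed

text \<open>Expanding the direction in \<open>Basis\<close> reduces joint continuity to continuity
  in the point for finitely many fixed directions, which \<open>Ck_on\<close> provides.\<close>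

lemma tendsto_D1:
  fixes F :: "'a::euclidean_space \<Rightarrow> 'b::real_normed_vector"
  assumes C: "Ck_on (Suc k) UNIV F" and y: "(y \<longlongrightarrow> x) G" and w: "(w \<longlongrightarrow> w0) G"
  shows "((\<lambda>t. D1 F (y t) (w t)) \<longlongrightarrow> D1 F x w0) G"
proof -
  have eq: "D1 F z u = (\<Sum>b\<in>Basis. (u \<bullet> b) *\<^sub>R D1 F z b)" for z u
    using arg_cong[OF euclidean_representation[of u], of "D1 F z"]
    by (simp add: linear_sum[OF D1_linear[OF C]] linear_cmul[OF D1_linear[OF C]])
  have "continuous_on UNIV (\<lambda>z. D1 F z b)" for b
    using Ck_on_le[OF D1_Ck[OF C, of b] le0] by (simp only: Ck_on.simps)
  then have "((\<lambda>t. D1 F (y t) b) \<longlongrightarrow> D1 F x b) G" for b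
    using y by (intro isCont_tendsto_compose[of x "\<lambda>z. D1 F z b"]) (simp_all add: continuous_on_eq_continuous_at)
  then have "((\<lambda>t. \<Sum>b\<in>Basis. (w t \<bullet> b) *\<^sub>R D1 F (y t) b) \<longlongrightarrow> (\<Sum>b\<in>Basis. (w0 \<bullet> b) *\<^sub>R D1 F x b)) G"
    by (intro tendsto_intros w)
  then show ?thesis by (simp only: eq[symmetric])
qed

lemma continuous_on_D1:
  fixes F :: "'a::euclidean_space \<Rightarrow> 'b::real_normed_vector" and y w :: "'c::t2_space \<Rightarrow> 'a"
  assumes "Ck_on (Suc k) UNIV F" "continuous_on S y" "continuous_on S w"
  shows "continuous_on S (\<lambda>t. D1 F (y t) (w t))"
  using assms(2,3) unfolding continuous_on_def by (blast intro: tendsto_D1[OF assms(1)])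

text \<open>The derivatives along basis vectors are locally Lipschitz. On the smallest of these
  finitely many balls the derivative is Lipschitz in operator norm, and linearizing along a segment
  gives the square. The base point \<open>y\<close> is allowed to vary because in
  \<open>expands_compose\<close> it moves with \<xi>.\<close>

lemma C2_quadratic_remainder:
  fixes F :: "'a::euclidean_space \<Rightarrow> 'b::real_normed_vector"
  assumes C: "Ck_on (Suc (Suc k)) UNIV F"
  obtains L d where "0 < d" "\<And>y z. y \<in> cball x d \<Longrightarrow> z \<in> cball x d \<Longrightarrow>
     norm (F z - F y - D1 F y (z - y)) \<le> L * norm (z - y)^2"
proof -
  have "\<exists>L r. 0 < r \<and> L-lipschitz_on (cball x r) (\<lambda>y. D1 F y b)" for b
    by (rule locally_lipschitz_of_C1[of UNIV x "\<lambda>y. D1 F y b" "\<lambda>y. D1 (\<lambda>z. D1 F z b) y"])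
      (auto simp del: Ck_on.simps intro!: D1_has_derivative[OF D1_Ck[OF C]] continuous_on_D1[OF D1_Ck[OF C]] continuous_intros)
  then obtain L r where r: "\<And>b. 0 < r b" and L: "\<And>b. (L b)-lipschitz_on (cball x (r b)) (\<lambda>y. D1 F y b)" by metis
  define d where "d = Min (r ` Basis)"
  have d: "0 < d" "\<And>b. b \<in> Basis \<Longrightarrow> d \<le> r b" by (auto simp: d_def r)
  note lin = D1_linear[OF C]
  have op: "norm (D1 F p u - D1 F y u) \<le> (\<Sum>b\<in>Basis. L b) * norm (p - y) * norm u"
    if "p \<in> cball x d" "y \<in> cball x d" for p y u
  proof -
    have "D1 F p u - D1 F y u = (\<Sum>b\<in>Basis. (u \<bullet> b) *\<^sub>R (D1 F p b - D1 F y b))"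
      using arg_cong[OF euclidean_representation[of u], of "\<lambda>u. D1 F p u - D1 F y u"]
      by (simp add: linear_sum[OF lin] linear_cmul[OF lin] scaleR_diff_right sum_subtractf)
    also have "norm \<dots> \<le> (\<Sum>b\<in>Basis. norm u * (L b * norm (p - y)))"
    proof (rule sum_norm_le)
      fix b :: 'a assume b: "b \<in> Basis"
      have "dist (D1 F p b) (D1 F y b) \<le> L b * dist p y"
        by (rule lipschitz_onD[OF L]) (use that d(2)[OF b] in auto)
      then show "norm ((u \<bullet> b) *\<^sub>R (D1 F p b - D1 F y b)) \<le> norm u * (L b * norm (p - y))"
        by (auto simp: dist_norm intro!: mult_mono Basis_le_norm b)
    qed
    finally show ?thesis by (simp add: sum_distrib_left sum_distrib_right mult_ac)
  qed
  have L0: "0 \<le> (\<Sum>b\<in>Basis. L b)" using L by (intro sum_nonneg) (blast intro: lipschitz_on_nonneg)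
  show ?thesis
  proof (rule that[OF d(1)])
    fix y z assume yz: "y \<in> cball x d" "z \<in> cball x d"
    let ?B = "(\<Sum>b\<in>Basis. L b) * norm (z - y)"
    have seg: "p \<in> cball x d" "norm (p - y) \<le> norm (z - y)" if "p \<in> closed_segment y z" for p
      using closed_segment_subset[OF yz convex_cball] segment_bound(1)[OF that] that by blast+
    have "norm (F z - F y - D1 F y (z - y)) \<le> norm (z - y) * ?B"
    proof (rule differentiable_bound_linearization[where S="closed_segment y z" and f'="D1 F"])
      show "y + t *\<^sub>R (z - y) \<in> closed_segment y z" if "t \<in> {0..1}" for t
        using that by (auto simp: in_segment algebra_simps intro!: exI[of _ t])
      show "(F has_derivative D1 F p) (at p within closed_segment y z)" for p
        by (rule has_derivative_at_withinI[OF D1_has_derivative[OF C]])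
      show "onorm (D1 F p - D1 F y) \<le> ?B" if "p \<in> closed_segment y z" for p
      proof (rule onorm_bound)
        fix u
        have "norm (D1 F p u - D1 F y u) \<le> (\<Sum>b\<in>Basis. L b) * norm (p - y) * norm u"
          by (rule op[OF seg(1)[OF that] yz(1)])
        also have "\<dots> \<le> ?B * norm u" using seg(2)[OF that] L0 by (intro mult_right_mono mult_left_mono) auto
        finally show "norm ((D1 F p - D1 F y) u) \<le> ?B * norm u" by simp
      qed (use L0 in auto)
    qed simp
    then show "norm (F z - F y - D1 F y (z - y)) \<le> (\<Sum>b\<in>Basis. L b) * norm (z - y)^2"
      by (simp add: power2_eq_square mult_ac)
  qed
qed

lemma D1_has_vector_derivative:
  fixes F :: "'a::euclidean_space \<Rightarrow> 'b::real_normed_vector"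
  assumes "Ck_on (Suc k) UNIV F" "(g has_vector_derivative g') (at t within S)"
  shows "((\<lambda>t. F (g t)) has_vector_derivative D1 F (g t) g') (at t within S)"
proof -
  have "((\<lambda>t. F (g t)) has_derivative (\<lambda>h. D1 F (g t) (h *\<^sub>R g'))) (at t within S)"
    using assms(2) D1_has_derivative[OF assms(1)] unfolding has_vector_derivative_def
    by (rule has_derivative_compose)
  then show ?thesis by (simp add: has_vector_derivative_def linear_cmul[OF D1_linear[OF assms(1)]])
qed

lemma has_vector_derivative_difference_quotient:
  assumes "(f has_vector_derivative f') (at t)"
  shows "((\<lambda>h. (1/h) *\<^sub>R (f (t + h) - f t)) \<longlongrightarrow> f') (at 0)"
proof -
  have "((\<lambda>h. norm (f (t + h) - f t - h *\<^sub>R f') / norm h) \<longlongrightarrow> 0) (at 0)"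
    using assms by (simp add: has_vector_derivative_def has_derivative_at)
  then have "((\<lambda>h. norm ((1/h) *\<^sub>R (f (t + h) - f t) - f')) \<longlongrightarrow> 0) (at 0)"
  proof (rule Lim_transform_eventually, intro eventually_at_filter[THEN iffD2] always_eventually allI impI)
    fix h :: real assume h: "h \<noteq> 0"
    have "norm (f (t + h) - f t - h *\<^sub>R f') / norm h = norm ((1/h) *\<^sub>R (f (t + h) - f t - h *\<^sub>R f'))"
      by (simp add: divide_inverse)
    also have "\<dots> = norm ((1/h) *\<^sub>R (f (t + h) - f t) - f')" using h by (simp add: scaleR_diff_right)
    finally show "norm (f (t + h) - f t - h *\<^sub>R f') / norm h = norm ((1/h) *\<^sub>R (f (t + h) - f t) - f')" .
  qed
  then show ?thesis by (simp add: tendsto_norm_zero_iff LIM_zero_iff)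
qed

text \<open>Splitting off \<open>\<xi> v\<close> first, with the quadratically small rest \<open>r\<close> entering only through
  the derivative of \<open>F\<close> at \<open>x + \<xi> v\<close>, makes the symmetry of the second derivative unnecessary.\<close>

lemma expands_compose:
  fixes F :: "'a::euclidean_space \<Rightarrow> 'b::real_normed_vector"
  assumes C: "Ck_on 3 UNIV F" and r: "expands r 0 0 r2 r3"
  shows "expands (\<lambda>\<xi>. F (x + \<xi> *\<^sub>R v + r \<xi>)) (F x) (D1 F x v) ((1/2) *\<^sub>R D2 F x v v + D1 F x r2)
           ((1/6) *\<^sub>R D3 F x v v v + D2 F x r2 v + D1 F x r3)"
proof -
  have C3: "Ck_on (Suc (Suc (Suc 0))) UNIV F" using C by (simp add: numeral_3_eq_3 del: Ck_on.simps)
  note C2 = D1_Ck[OF C3] note C1 = D1_Ck[OF C2]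
  obtain e where e: "(e \<longlongrightarrow> 0) (at 0)" and re: "\<And>\<xi>. \<xi> \<noteq> 0 \<Longrightarrow> r \<xi> = 0 + \<xi> *\<^sub>R 0 + \<xi>^2 *\<^sub>R r2 + \<xi>^3 *\<^sub>R (r3 + e \<xi>)"
    using r by (rule expandsE) blast
  let ?y = "\<lambda>\<xi>. x + \<xi> *\<^sub>R v"
  have y: "(?y has_vector_derivative v) (at \<xi>)" for \<xi> by (auto intro!: derivative_eq_intros)
  have yt: "(?y \<longlongrightarrow> x) (at 0)" by (auto intro!: tendsto_eq_intros)
  have rt: "(r \<longlongrightarrow> 0) (at 0)" using expands_tendsto[OF r] .
  have 1: "expands (\<lambda>\<xi>. F (?y \<xi>)) (F x) (D1 F x v) ((1/2) *\<^sub>R D2 F x v v) ((1/6) *\<^sub>R D3 F x v v v)"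
  proof -
    have "continuous_on {-1<..<1} (\<lambda>\<xi>. D1 (\<lambda>z. D1 (\<lambda>z. D1 F z v) z v) (?y \<xi>) v)"
      by (intro continuous_on_D1[OF C1] continuous_intros)
    from expands_taylor[OF zero_less_one D1_has_vector_derivative[OF C3 y]
        D1_has_vector_derivative[OF C2 y] D1_has_vector_derivative[OF C1 y] this]
    show ?thesis unfolding D2_eq_D1 D3_eq_D1 by simp
  qed
  \<comment> \<open>\<open>D2 F x r2 v\<close> enters as the rate at which \<open>D1 F y r2\<close>
    changes when \<open>y\<close> leaves \<open>x\<close> along \<open>v\<close>; this fixes the
    order of its arguments.\<close>
  have 2: "expands (\<lambda>\<xi>. D1 F (?y \<xi>) (r \<xi>)) 0 0 (D1 F x r2) (D2 F x r2 v + D1 F x r3)"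
  proof (rule expandsI)
    let ?e = "\<lambda>\<xi>. D1 F (?y \<xi>) (r3 + e \<xi>) - D1 F x r3 + ((1/\<xi>) *\<^sub>R (D1 F (?y \<xi>) r2 - D1 F x r2) - D2 F x r2 v)"
    have "((\<lambda>\<xi>. D1 F (?y \<xi>) (r3 + e \<xi>)) \<longlongrightarrow> D1 F x (r3 + 0)) (at 0)"
      by (intro tendsto_D1[OF C3] yt tendsto_intros e)
    moreover have "((\<lambda>\<xi>. (1/\<xi>) *\<^sub>R (D1 F (?y \<xi>) r2 - D1 F x r2)) \<longlongrightarrow> D2 F x r2 v) (at 0)"
      using has_vector_derivative_difference_quotient[OF D1_has_vector_derivative[OF C2 y[of 0], of r2]]
      by (simp add: D2_eq_D1)
    ultimately show "(?e \<longlongrightarrow> 0) (at 0)"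
      using tendsto_add[OF LIM_zero LIM_zero] by fastforce
    fix \<xi> :: real assume "\<xi> \<noteq> 0"
    then show "D1 F (?y \<xi>) (r \<xi>) = 0 + \<xi> *\<^sub>R 0 + \<xi>^2 *\<^sub>R D1 F x r2 + \<xi>^3 *\<^sub>R (D2 F x r2 v + D1 F x r3 + ?e \<xi>)"
      by (simp add: re linear_add[OF D1_linear[OF C3]] linear_cmul[OF D1_linear[OF C3]] scaleR_add_right
          scaleR_diff_right power3_eq_cube power2_eq_square)
  qed
  \<comment> \<open>As \<open>r \<xi>\<close> is of order \<open>\<xi>^2\<close>, an error quadratic
    in it is of order \<open>\<xi>^4\<close> and contributes to no coefficient.\<close>
  have 3: "expands (\<lambda>\<xi>. F (?y \<xi> + r \<xi>) - F (?y \<xi>) - D1 F (?y \<xi>) (r \<xi>)) 0 0 0 0"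
  proof -
    obtain L d where d: "0 < d" and L: "\<And>y z. y \<in> cball x d \<Longrightarrow> z \<in> cball x d \<Longrightarrow>
       norm (F z - F y - D1 F y (z - y)) \<le> L * norm (z - y)^2"
      by (rule C2_quadratic_remainder[OF C3, of x]) blast
    have "((\<lambda>\<xi>. ?y \<xi> + r \<xi>) \<longlongrightarrow> x + 0) (at 0)" by (intro tendsto_add yt rt)
    then have ev: "\<forall>\<^sub>F \<xi> in at 0. ?y \<xi> + r \<xi> \<in> cball x d" "\<forall>\<^sub>F \<xi> in at 0. ?y \<xi> \<in> cball x d"
      using tendstoD[OF _ d, of _ x] yt d by (fastforce simp: dist_commute elim: eventually_mono)+
    let ?R = "\<lambda>\<xi>. F (?y \<xi> + r \<xi>) - F (?y \<xi>) - D1 F (?y \<xi>) (r \<xi>)"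
    let ?k = "\<lambda>\<xi>. r2 + \<xi> *\<^sub>R (r3 + e \<xi>)"
    have "((\<lambda>\<xi>. (1 / \<xi>^3) *\<^sub>R ?R \<xi>) \<longlongrightarrow> 0) (at 0)"
    proof (rule Lim_null_comparison)
      have "((\<lambda>\<xi>. L * norm (?k \<xi>)^2 * \<bar>\<xi>\<bar>) \<longlongrightarrow> L * norm (r2 + 0 *\<^sub>R (r3 + 0))^2 * \<bar>0\<bar>) (at 0)"
        by (intro tendsto_intros e)
      then show "((\<lambda>\<xi>. L * norm (?k \<xi>)^2 * \<bar>\<xi>\<bar>) \<longlongrightarrow> 0) (at 0)" by simp
      show "\<forall>\<^sub>F \<xi> in at 0. norm ((1 / \<xi>^3) *\<^sub>R ?R \<xi>) \<le> L * norm (?k \<xi>)^2 * \<bar>\<xi>\<bar>"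
        using ev eventually_neq_at_within[of 0 0 UNIV]
      proof eventually_elim
        case (elim \<xi>)
        have "r \<xi> = \<xi>^2 *\<^sub>R ?k \<xi>" using re[OF elim(3)] by (simp add: scaleR_add_right power3_eq_cube power2_eq_square)
        then have nr: "norm (r \<xi>)^2 = \<bar>\<xi>\<bar> * \<bar>\<xi>\<bar>^3 * norm (?k \<xi>)^2"
          by (simp add: power_mult_distrib power2_eq_square power3_eq_cube mult_ac)
        have "norm ((1 / \<xi>^3) *\<^sub>R ?R \<xi>) = norm (?R \<xi>) / \<bar>\<xi>\<bar>^3" by (simp add: power_abs divide_inverse)
        also have "\<dots> \<le> L * norm (r \<xi>)^2 / \<bar>\<xi>\<bar>^3"
          using L[OF elim(2) elim(1)] by (intro divide_right_mono) auto
        also have "\<dots> = L * norm (?k \<xi>)^2 * \<bar>\<xi>\<bar>" using elim(3) by (simp add: nr)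
        finally show ?case .
      qed
    qed
    then show ?thesis by (rule expandsI) simp
  qed
  show ?thesis using expands_add[OF expands_add[OF 1 2] 3] by (simp add: add.assoc)
qed

subsection \<open>The homological equation and linear periodic systems\<close>

definition partial1 :: "(real \<times> real \<Rightarrow> 'b::real_normed_vector) \<Rightarrow> real \<times> real \<Rightarrow> 'b" where
  "partial1 f p = frechet_derivative f (at p) (1, 0)"

definition partial2 :: "(real \<times> real \<Rightarrow> 'b::real_normed_vector) \<Rightarrow> real \<times> real \<Rightarrow> 'b" where
  "partial2 f p = frechet_derivative f (at p) (0, 1)"

lemma Ck_on_partial:
  assumes "Ck_on (Suc k) S f"
  shows "Ck_on k S (partial1 f)" "Ck_on k S (partial2 f)"
  using assms by (simp_all add: partial1_def[abs_def] partial2_def[abs_def])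

lemma has_vector_derivative_partial1:
  assumes "Ck_on (Suc k) S f" "(s, \<xi>) \<in> S"
  shows "((\<lambda>s. f (s, \<xi>)) has_vector_derivative partial1 f (s, \<xi>)) (at s)"
proof -
  note d = Ck_on_Suc_has_derivative[OF assms]
  have "((\<lambda>s. (s, \<xi>)) has_derivative (\<lambda>h. h *\<^sub>R (1, 0))) (at s)" by (auto intro!: derivative_eq_intros)
  from has_derivative_compose[OF this d] show ?thesis
    by (simp add: has_vector_derivative_def partial1_def linear_cmul[OF has_derivative_linear[OF d]] del: scaleR_Pair)
qed

lemma has_vector_derivative_partial2:
  assumes "Ck_on (Suc k) S f" "(s, \<xi>) \<in> S"
  shows "((\<lambda>\<xi>. f (s, \<xi>)) has_vector_derivative partial2 f (s, \<xi>)) (at \<xi>)"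
proof -
  note d = Ck_on_Suc_has_derivative[OF assms]
  have "((\<lambda>\<xi>. (s, \<xi>)) has_derivative (\<lambda>h. h *\<^sub>R (0, 1))) (at \<xi>)" by (auto intro!: derivative_eq_intros)
  from has_derivative_compose[OF this d] show ?thesis
    by (simp add: has_vector_derivative_def partial2_def linear_cmul[OF has_derivative_linear[OF d]] del: scaleR_Pair)
qed

lemma expands_of_Ck:
  assumes \<delta>: "0 < \<delta>" and C: "Ck_on 3 (UNIV \<times> {-\<delta><..<\<delta>}) f"
  shows "expands (\<lambda>\<xi>. f (s, \<xi>)) (f (s, 0)) (partial2 f (s, 0)) ((1/2) *\<^sub>R partial2 (partial2 f) (s, 0))
           ((1/6) *\<^sub>R partial2 (partial2 (partial2 f)) (s, 0))"
proof -
  have C3: "Ck_on (Suc (Suc (Suc 0))) (UNIV \<times> {-\<delta><..<\<delta>}) f" using C by (simp add: numeral_3_eq_3 del: Ck_on.simps)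
  note C2 = Ck_on_partial(2)[OF C3] note C1 = Ck_on_partial(2)[OF C2]
  have "continuous_on (UNIV \<times> {-\<delta><..<\<delta>}) (partial2 (partial2 (partial2 f)))"
    using Ck_on_partial(2)[OF C1] by simp
  then have "continuous_on {-\<delta><..<\<delta>} (\<lambda>\<xi>. partial2 (partial2 (partial2 f)) (s, \<xi>))"
    by (rule continuous_on_compose2) (auto intro!: continuous_intros)
  then show ?thesis
    by (intro expands_taylor[OF \<delta>, of "\<lambda>\<xi>. f (s, \<xi>)" "\<lambda>\<xi>. partial2 f (s, \<xi>)" "\<lambda>\<xi>. partial2 (partial2 f) (s, \<xi>)"]
        has_vector_derivative_partial2[OF C3] has_vector_derivative_partial2[OF C2] has_vector_derivative_partial2[OF C1]) auto
qed

text \<open>Class C4 leaves three \<xi>-derivatives after one \<tau>-derivative. For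
  \<open>partial2 H\<close> only the vanishing constant term is recorded, since this factor gets
  multiplied by \<open>Q\<close>, which starts at order 3.\<close>

lemma manifold_coefficients:
  fixes H :: "real \<times> real \<Rightarrow> 'b::banach"
  assumes \<delta>: "0 < \<delta>" and C: "Ck_on 4 (UNIV \<times> {-\<delta><..<\<delta>}) H"
    and ex: "\<And>\<tau>. expands (\<lambda>\<xi>. H (\<tau>, \<xi>)) 0 0 ((1/2) *\<^sub>R h2 \<tau>) ((1/6) *\<^sub>R h3 \<tau>)"
  obtains h2' h3' where "\<And>\<tau>. (h2 has_vector_derivative h2' \<tau>) (at \<tau>)" "\<And>\<tau>. (h3 has_vector_derivative h3' \<tau>) (at \<tau>)"
    "\<And>\<tau>. expands (\<lambda>\<xi>. partial1 H (\<tau>, \<xi>)) 0 0 ((1/2) *\<^sub>R h2' \<tau>) ((1/6) *\<^sub>R h3' \<tau>)"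
    "\<And>\<tau>. \<exists>b c d. expands (\<lambda>\<xi>. partial2 H (\<tau>, \<xi>)) 0 b c d"
proof -
  let ?D = "UNIV \<times> {-\<delta><..<\<delta>}"
  have C4: "Ck_on (Suc (Suc (Suc (Suc 0)))) ?D H" using C by (simp add: eval_nat_numeral del: Ck_on.simps)
  define K where "K = partial1 H"
  have K3: "Ck_on (Suc (Suc (Suc 0))) ?D K" unfolding K_def by (rule Ck_on_partial(1)[OF C4])
  note K2 = Ck_on_partial(2)[OF K3] note K1 = Ck_on_partial(2)[OF K2] note K0 = Ck_on_partial(2)[OF K1]
  have cont0: "continuous_on UNIV (\<lambda>\<tau>. f (\<tau>, 0))" if "Ck_on k ?D f" for k and f :: "real \<times> real \<Rightarrow> 'b"
  proof -
    have "continuous_on ?D f" using Ck_on_le[OF that, of 0] by simp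
    then show ?thesis
      by (rule continuous_on_compose2) (use \<delta> in \<open>auto intro!: continuous_intros\<close>)
  qed
  note der = expansion_coefficients_derivative[OF \<delta>, of "\<lambda>\<tau> \<xi>. H (\<tau>, \<xi>)" "\<lambda>\<tau> \<xi>. K (\<tau>, \<xi>)" "\<lambda>\<tau> \<xi>. partial2 K (\<tau>, \<xi>)"
      "\<lambda>\<tau> \<xi>. partial2 (partial2 K) (\<tau>, \<xi>)" "\<lambda>\<tau> \<xi>. partial2 (partial2 (partial2 K)) (\<tau>, \<xi>)"
      "\<lambda>_. 0" "\<lambda>_. 0" "\<lambda>\<tau>. (1/2) *\<^sub>R h2 \<tau>" "\<lambda>\<tau>. (1/6) *\<^sub>R h3 \<tau>",
      OF _ has_vector_derivative_partial2[OF K3] has_vector_derivative_partial2[OF K2] has_vector_derivative_partial2[OF K1]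
        _ cont0[OF K3] cont0[OF K2] cont0[OF K1] ex]
  have pre: "((\<lambda>\<tau>. H (\<tau>, \<xi>)) has_vector_derivative K (\<tau>, \<xi>)) (at \<tau>)" if "\<bar>\<xi>\<bar> < \<delta>" for \<tau> \<xi>
    unfolding K_def by (rule has_vector_derivative_partial1[OF C4]) (use that in auto)
  have mem: "(\<tau>, \<xi>) \<in> ?D" if "\<bar>\<xi>\<bar> < \<delta>" for \<tau> \<xi> using that by auto
  have c3: "continuous_on ?D (\<lambda>(\<tau>, \<xi>). partial2 (partial2 (partial2 K)) (\<tau>, \<xi>))" using K0 by simp
  note der = der[OF pre mem mem mem c3]
  have zero: "k = 0" if "((\<lambda>_. 0 :: 'b) has_vector_derivative k) (at \<tau>)" for k and \<tau> :: real
    using that vector_derivative_unique_at has_vector_derivative_const by blast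
  \<comment> \<open>The coefficients of order 0 and 1 of \<open>H\<close> are 0 for every \<tau>, so
    their \<tau>-derivatives, which are these two values, vanish.\<close>
  have k01: "K (\<tau>, 0) = 0" "partial2 K (\<tau>, 0) = 0" for \<tau>
    using zero[OF der(1)] zero[OF der(2)] by auto
  show ?thesis
  proof (rule that[of "\<lambda>\<tau>. partial2 (partial2 K) (\<tau>, 0)" "\<lambda>\<tau>. partial2 (partial2 (partial2 K)) (\<tau>, 0)"])
    fix \<tau>
    show "(h2 has_vector_derivative partial2 (partial2 K) (\<tau>, 0)) (at \<tau>)"
      using has_vector_derivative_scaleR[OF DERIV_const[of 2] der(3)[of \<tau>]] by simp
    show "(h3 has_vector_derivative partial2 (partial2 (partial2 K)) (\<tau>, 0)) (at \<tau>)"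
      using has_vector_derivative_scaleR[OF DERIV_const[of 6] der(4)[of \<tau>]] by simp
    show "expands (\<lambda>\<xi>. partial1 H (\<tau>, \<xi>)) 0 0 ((1/2) *\<^sub>R partial2 (partial2 K) (\<tau>, 0))
        ((1/6) *\<^sub>R partial2 (partial2 (partial2 K)) (\<tau>, 0))"
      using expands_of_Ck[OF \<delta>, of K \<tau>] K3 k01 by (simp add: K_def numeral_3_eq_3 del: Ck_on.simps)
    have "expands (\<lambda>\<xi>. H (\<tau>, \<xi>)) (H (\<tau>, 0)) (partial2 H (\<tau>, 0)) ((1/2) *\<^sub>R partial2 (partial2 H) (\<tau>, 0))
        ((1/6) *\<^sub>R partial2 (partial2 (partial2 H)) (\<tau>, 0))"
      by (rule expands_of_Ck[OF \<delta> Ck_on_le[OF C]]) simp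
    from expands_unique[OF ex[of \<tau>] this] have "partial2 H (\<tau>, 0) = 0" by simp
    then show "\<exists>b c d. expands (\<lambda>\<xi>. partial2 H (\<tau>, \<xi>)) 0 b c d"
      using expands_of_Ck[OF \<delta>, of "partial2 H" \<tau>] Ck_on_partial(2)[OF C4] by (auto simp: numeral_3_eq_3 simp del: Ck_on.simps)
  qed
qed

text \<open>In the application \<open>w\<close> is the derivative of \<open>v\<close>,
  \<open>K\<close> and \<open>G\<close> are the partial derivatives of \<open>H\<close>, and
  \<open>F x\<close> is the velocity of the cycle. Of the factor \<open>v + G\<close> only
  \<open>v\<close> reaches order 3, because \<open>Q\<close> starts with
  \<open>\<xi>^3\<close>.\<close>

lemma homological_equation_orders:
  fixes F :: "'a::euclidean_space \<Rightarrow> 'a"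
  assumes C: "Ck_on 3 UNIV F"
    and P: "expands P 1 (-1) a1 a2" and Q: "expands Q 0 0 0 c"
    and K: "expands K 0 0 k2 k3" and G: "expands G 0 g1 g2 g3" and H: "expands H 0 0 r2 r3"
    and eq: "\<forall>\<^sub>F \<xi> in at 0. P \<xi> *\<^sub>R (F x + \<xi> *\<^sub>R w + K \<xi>) + Q \<xi> *\<^sub>R (v + G \<xi>) = F (x + \<xi> *\<^sub>R v + H \<xi>)"
  shows "k2 - w + a1 *\<^sub>R F x = (1/2) *\<^sub>R D2 F x v v + D1 F x r2"
    "k3 - k2 + a1 *\<^sub>R w + a2 *\<^sub>R F x + c *\<^sub>R v = (1/6) *\<^sub>R D3 F x v v v + D2 F x r2 v + D1 F x r3"
proof -
  have "expands (\<lambda>\<xi>. F x + \<xi> *\<^sub>R w + K \<xi>) (F x) w k2 k3"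
    using expands_add[OF expands_poly[of "F x" w 0 0] K] by simp
  from expands_scaleR[OF P this]
  have 1: "expands (\<lambda>\<xi>. P \<xi> *\<^sub>R (F x + \<xi> *\<^sub>R w + K \<xi>)) (F x) (w - F x) (k2 - w + a1 *\<^sub>R F x)
      (k3 - k2 + a1 *\<^sub>R w + a2 *\<^sub>R F x)" by simp
  have "expands (\<lambda>\<xi>. v + G \<xi>) v g1 g2 g3" using expands_add[OF expands_poly[of v 0 0 0] G] by simp
  from expands_scaleR[OF Q this] have 2: "expands (\<lambda>\<xi>. Q \<xi> *\<^sub>R (v + G \<xi>)) 0 0 0 (c *\<^sub>R v)" by simp
  from expands_unique[OF expands_cong[OF expands_add[OF 1 2] eq] expands_compose[OF C H]]
  show "k2 - w + a1 *\<^sub>R F x = (1/2) *\<^sub>R D2 F x v v + D1 F x r2"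
    "k3 - k2 + a1 *\<^sub>R w + a2 *\<^sub>R F x + c *\<^sub>R v = (1/6) *\<^sub>R D3 F x v v v + D2 F x r2 v + D1 F x r3" by auto
qed

section \<open>Linear periodic systems and their adjoints\<close>

text \<open>At the endpoints only one-sided derivatives are given. A shift by \<open>T\<close>
  supplies the other side, and \<open>w T = w 0\<close> makes both agree. The chain rule for
  \<open>U\<close> asks for two-sided derivatives of \<open>v\<close>.\<close>

lemma periodic_has_vector_derivative:
  fixes v :: "real \<Rightarrow> 'b::real_normed_vector"
  assumes T: "0 < T" and per: "\<And>\<tau>. v (\<tau> + T) = v \<tau>"
    and der: "\<And>\<tau>. \<tau> \<in> {0..T} \<Longrightarrow> (v has_vector_derivative w \<tau>) (at \<tau> within {0..T})" and w: "w T = w 0"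
    and \<tau>: "\<tau> \<in> {0..T}"
  shows "(v has_vector_derivative w \<tau>) (at \<tau>)"
proof -
  have shift: "(v has_vector_derivative d) (at (t + r) within S)"
    if "(v has_vector_derivative d) (at t within ((\<lambda>s. s - r) ` S))" "\<And>s. v (s - r) = v s" for d t r S
  proof -
    have "(((\<lambda>s. v s) \<circ> (\<lambda>s. s - r)) has_vector_derivative (1 *\<^sub>R d)) (at (t + r) within S)"
      by (rule vector_diff_chain_within) (use that(1) in \<open>auto intro!: derivative_eq_intros\<close>)
    then show ?thesis using that(2) by (simp add: o_def)
  qed
  have 0: "(v has_vector_derivative w 0) (at 0)"
  proof -
    have "(\<lambda>s. s - (- T)) ` {-T..0} = {0..T}" by (auto simp: image_iff intro!: bexI[of _ "_ - T"])
    then have "(v has_vector_derivative w 0) (at (T + (- T)) within {-T..0})"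
      using shift[of "w 0" T "-T" "{-T..0}"] der[of T] T w per by simp
    moreover have "(v has_vector_derivative w 0) (at 0 within {0..T})" using der[of 0] T by simp
    ultimately have "(v has_vector_derivative w 0) (at 0 within ({-T..0} \<union> {0..T}))"
      unfolding has_vector_derivative_def has_derivative_within by (auto intro: Lim_Un)
    moreover have "{-T..0} \<union> {0..T} = {-T..T}" using T by auto
    ultimately show ?thesis using T by (simp add: at_within_Icc_at)
  qed
  have per': "v (s - T) = v s" for s using per[of "s - T"] by simp
  have "(v has_vector_derivative w T) (at T)"
    using shift[of "w 0" 0 T UNIV] 0 per' w by (simp add: surj_def has_vector_derivative_at_within)
  then show ?thesis using 0 der[OF \<tau>] \<tau> by (cases "\<tau> = 0 \<or> \<tau> = T") (auto simp: at_within_Icc_at)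
qed

text \<open>Energy estimate: by Cauchy-Schwarz the squared norm grows at relative rate at most
  \<open>2 * K\<close>, so multiplied by \<open>exp (- 2 * K * t)\<close> it cannot rise above its
  initial value 0.\<close>

lemma linear_ode_zero:
  fixes d :: "real \<Rightarrow> 'a::real_inner"
  assumes bd: "\<And>t u. t \<in> {0..T} \<Longrightarrow> norm (A t u) \<le> K * norm u"
    and der: "\<And>t. t \<in> {0..T} \<Longrightarrow> (d has_vector_derivative A t (d t)) (at t within {0..T})"
    and "d 0 = 0" and t: "t \<in> {0..T}"
  shows "d t = 0"
proof -
  let ?N = "\<lambda>t. (d t \<bullet> d t) * exp (- 2 * K * t)"
  have N: "(?N has_real_derivative (2 * (d s \<bullet> A s (d s)) - 2 * K * (d s \<bullet> d s)) * exp (- 2 * K * s)) (at s within {0..T})"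
    if "s \<in> {0..T}" for s
  proof -
    have "((\<lambda>t. d t \<bullet> d t) has_derivative (\<lambda>h. d s \<bullet> (h *\<^sub>R A s (d s)) + (h *\<^sub>R A s (d s)) \<bullet> d s)) (at s within {0..T})"
      using der[OF that] unfolding has_vector_derivative_def by (intro has_derivative_inner)
    moreover have "(\<lambda>h. d s \<bullet> (h *\<^sub>R A s (d s)) + (h *\<^sub>R A s (d s)) \<bullet> d s) = (*) (2 * (d s \<bullet> A s (d s)))"
      by (auto simp: inner_commute)
    ultimately have "((\<lambda>t. d t \<bullet> d t) has_real_derivative 2 * (d s \<bullet> A s (d s))) (at s within {0..T})"
      unfolding has_field_derivative_def by simp
    then show ?thesis by (auto intro!: derivative_eq_intros simp: algebra_simps)
  qed
  have "?N t \<le> ?N 0"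
  proof (rule DERIV_nonpos_imp_decreasing_open[of 0 t ?N])
    show "0 \<le> t" using t by auto
    fix s assume s: "0 < s" "s < t"
    have "d s \<bullet> A s (d s) \<le> norm (d s) * norm (A s (d s))" by (rule norm_cauchy_schwarz)
    also have "\<dots> \<le> norm (d s) * (K * norm (d s))" using bd[of s "d s"] s t by (intro mult_left_mono) auto
    also have "\<dots> = K * (d s \<bullet> d s)" by (simp add: power2_norm_eq_inner[symmetric] power2_eq_square mult_ac)
    finally have "(2 * (d s \<bullet> A s (d s)) - 2 * K * (d s \<bullet> d s)) * exp (- 2 * K * s) \<le> 0"
      by (intro mult_nonpos_nonneg) auto
    then show "\<exists>y. (?N has_real_derivative y) (at s) \<and> y \<le> 0"
      using N[of s] s t by (auto simp: at_within_Icc_at)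
  next
    show "continuous_on {0..t} ?N"
      by (rule continuous_on_subset[OF DERIV_continuous_on[OF N]]) (use t in auto)
  qed
  then have "d t \<bullet> d t \<le> 0" using \<open>d 0 = 0\<close> by (simp add: mult_le_0_iff)
  then show ?thesis using inner_ge_zero[of "d t"] by simp
qed

text \<open>In the derivative of the inner product of \<open>p\<close> and \<open>q\<close> the two
  terms with \<open>A\<close> cancel, and periodicity removes the boundary terms. The uses are
  \<open>f = 0\<close> with \<open>p = \<phi>s\<close>, and \<open>f = \<phi>s\<close> with
  \<open>p = vs\<close>.\<close>

lemma adjoint_has_integral:
  fixes A :: "real \<Rightarrow> real^'n^'n" and p q :: "real \<Rightarrow> real^'n"
  assumes "0 \<le> T"
    and p: "\<And>\<tau>. \<tau> \<in> {0..T} \<Longrightarrow> (p has_vector_derivative - (transpose (A \<tau>) *v p \<tau>) - f \<tau>) (at \<tau> within {0..T})"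
    and q: "\<And>\<tau>. \<tau> \<in> {0..T} \<Longrightarrow> (q has_vector_derivative A \<tau> *v q \<tau> + g \<tau>) (at \<tau> within {0..T})"
    and "p T = p 0" "q T = q 0"
  shows "((\<lambda>\<tau>. p \<tau> \<bullet> g \<tau> - f \<tau> \<bullet> q \<tau>) has_integral 0) {0..T}"
proof -
  have "((\<lambda>\<tau>. p \<tau> \<bullet> g \<tau> - f \<tau> \<bullet> q \<tau>) has_integral (p T \<bullet> q T - p 0 \<bullet> q 0)) {0..T}"
  proof (rule fundamental_theorem_of_calculus[OF \<open>0 \<le> T\<close>])
    fix \<tau> assume \<tau>: "\<tau> \<in> {0..T}"
    have "((\<lambda>\<tau>. p \<tau> \<bullet> q \<tau>) has_vector_derivative
        p \<tau> \<bullet> (A \<tau> *v q \<tau> + g \<tau>) + (- (transpose (A \<tau>) *v p \<tau>) - f \<tau>) \<bullet> q \<tau>) (at \<tau> within {0..T})"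
      by (rule bounded_bilinear.has_vector_derivative[OF bounded_bilinear_inner p[OF \<tau>] q[OF \<tau>]])
    also have "p \<tau> \<bullet> (A \<tau> *v q \<tau> + g \<tau>) + (- (transpose (A \<tau>) *v p \<tau>) - f \<tau>) \<bullet> q \<tau> = p \<tau> \<bullet> g \<tau> - f \<tau> \<bullet> q \<tau>"
      using dot_lmul_matrix[of "p \<tau>" "A \<tau>" "q \<tau>"] by (simp add: inner_add_right inner_diff_left)
    finally show "((\<lambda>\<tau>. p \<tau> \<bullet> q \<tau>) has_vector_derivative p \<tau> \<bullet> g \<tau> - f \<tau> \<bullet> q \<tau>) (at \<tau> within {0..T})" .
  qed
  then show ?thesis using assms by simp
qed

section \<open>Equations for the coefficients of the manifold\<close>

text \<open>The C1 remainders \<open>R\<close> and \<open>S\<close> make the planar field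
  \<open>(P, Q)\<close> locally Lipschitz, which is what \<open>invariance_equation\<close> asks
  for; the derivative of \<open>H\<close> then splits into its two partial derivatives by
  linearity.\<close>

lemma manifold_homological_equation:
  fixes F :: "real^'n \<Rightarrow> real^'n" and u0 v :: "real \<Rightarrow> real^'n" and H :: "real \<times> real \<Rightarrow> real^'n"
  assumes H: "Ck_on (Suc k) (UNIV \<times> {-\<delta><..<\<delta>}) H"
    and R: "Ck_on 1 (UNIV \<times> {-\<delta><..<\<delta>}) R" and S: "Ck_on 1 (UNIV \<times> {-\<delta><..<\<delta>}) S"
    and P: "P = (\<lambda>(\<tau>, \<xi>). 1 - \<xi> + a1 * \<xi>^2 + a2 * \<xi>^3 + R (\<tau>, \<xi>))"
    and Q: "Q = (\<lambda>(\<tau>, \<xi>). c * \<xi>^3 + S (\<tau>, \<xi>))"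
    and U: "U = (\<lambda>(\<tau>, \<xi>). u0 \<tau> + \<xi> *\<^sub>R v \<tau> + H (\<tau>, \<xi>))"
    and inv: "\<forall>a b x y.
           (\<forall>t\<in>{a<..<b::real}. \<bar>y t\<bar> < \<delta> \<and>
              (x has_real_derivative P (x t, y t)) (at t) \<and>
              (y has_real_derivative Q (x t, y t)) (at t)) \<longrightarrow>
           (\<forall>t\<in>{a<..<b}. ((\<lambda>t. U (x t, y t)) has_vector_derivative F (U (x t, y t))) (at t))"
    and u0: "(u0 has_vector_derivative u0') (at \<tau>)" and v: "(v has_vector_derivative v') (at \<tau>)"
    and \<xi>: "\<bar>\<xi>\<bar> < \<delta>"
  shows "P (\<tau>, \<xi>) *\<^sub>R (u0' + \<xi> *\<^sub>R v' + partial1 H (\<tau>, \<xi>)) + Q (\<tau>, \<xi>) *\<^sub>R (v \<tau> + partial2 H (\<tau>, \<xi>))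
     = F (u0 \<tau> + \<xi> *\<^sub>R v \<tau> + H (\<tau>, \<xi>))"
proof -
  let ?D = "UNIV \<times> {-\<delta><..<\<delta>}"
  have mem: "(\<tau>, \<xi>) \<in> ?D" using \<xi> by auto
  have dR: "(R has_derivative frechet_derivative R (at p)) (at p)"
    and dS: "(S has_derivative frechet_derivative S (at p)) (at p)" if "p \<in> ?D" for p
    using Ck_on_Suc_has_derivative[of 0 ?D _ p] R S that by (simp_all del: Ck_on.simps)
  have cR: "continuous_on ?D (\<lambda>p. frechet_derivative R (at p) w)"
    and cS: "continuous_on ?D (\<lambda>p. frechet_derivative S (at p) w)" for w
    by (cases w, use R S in simp)+
  have P': "P p = 1 - snd p + a1 * snd p^2 + a2 * snd p^3 + R p" and Q': "Q p = c * snd p^3 + S p" for p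
    by (simp_all add: P Q case_prod_beta)
  let ?f' = "\<lambda>p w. (- snd w + a1 * (2 * snd p * snd w) + a2 * (3 * snd p^2 * snd w) + frechet_derivative R (at p) w,
    c * (3 * snd p^2 * snd w) + frechet_derivative S (at p) w)"
  obtain L r where "0 < r" "cball (\<tau>, \<xi>) r \<subseteq> ?D" "L-lipschitz_on (cball (\<tau>, \<xi>) r) (\<lambda>p. (P p, Q p))"
  proof (rule locally_lipschitz_of_C1[OF _ mem, of "\<lambda>p. (P p, Q p)" ?f'])
    show "open ?D" by (intro open_Times) auto
    show "((\<lambda>p. (P p, Q p)) has_derivative ?f' p) (at p)" if "p \<in> ?D" for p
      unfolding P' Q' by (auto intro!: derivative_eq_intros dR[OF that] dS[OF that] simp: power2_eq_square algebra_simps)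
    show "continuous_on ?D (\<lambda>p. ?f' p w)" for w
      by (intro continuous_intros cR cS)
  qed
  note lip = this
  let ?U' = "\<lambda>w. fst w *\<^sub>R u0' + (\<xi> *\<^sub>R fst w *\<^sub>R v' + snd w *\<^sub>R v \<tau>) + frechet_derivative H (at (\<tau>, \<xi>)) w"
  have Hd: "(H has_derivative frechet_derivative H (at (\<tau>, \<xi>))) (at (\<tau>, \<xi>))"
    by (rule Ck_on_Suc_has_derivative[OF H mem])
  have fst: "(fst has_derivative fst) (at (\<tau>, \<xi>))" and snd: "(snd has_derivative snd) (at (\<tau>, \<xi>))"
    by (auto intro!: derivative_eq_intros)
  have 1: "((\<lambda>p. u0 (fst p)) has_derivative (\<lambda>w. fst w *\<^sub>R u0')) (at (\<tau>, \<xi>))"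
    using has_derivative_compose[OF fst, of u0 "\<lambda>h. h *\<^sub>R u0'"] u0 by (simp add: has_vector_derivative_def)
  have 2: "((\<lambda>p. v (fst p)) has_derivative (\<lambda>w. fst w *\<^sub>R v')) (at (\<tau>, \<xi>))"
    using has_derivative_compose[OF fst, of v "\<lambda>h. h *\<^sub>R v'"] v by (simp add: has_vector_derivative_def)
  have "((\<lambda>p. u0 (fst p) + snd p *\<^sub>R v (fst p) + H p) has_derivative ?U') (at (\<tau>, \<xi>))"
    using has_derivative_add[OF has_derivative_add[OF 1 has_derivative_scaleR[OF snd 2]] Hd] by simp
  then have "(U has_derivative ?U') (at (\<tau>, \<xi>))" by (simp add: U case_prod_beta')
  then have "?U' (P (\<tau>, \<xi>), Q (\<tau>, \<xi>)) = F (U (\<tau>, \<xi>))"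
    by (rule invariance_equation[OF lip(3,1,2)]) (use inv in blast)
  moreover have "frechet_derivative H (at (\<tau>, \<xi>)) (p, q) = p *\<^sub>R partial1 H (\<tau>, \<xi>) + q *\<^sub>R partial2 H (\<tau>, \<xi>)" for p q
  proof -
    have lin: "linear (frechet_derivative H (at (\<tau>, \<xi>)))" using Hd has_derivative_linear by blast
    have "(p, q) = p *\<^sub>R (1, 0) + q *\<^sub>R (0, 1)" by simp
    then show ?thesis unfolding partial1_def partial2_def
      by (metis linear_add[OF lin] linear_cmul[OF lin])
  qed
  ultimately show ?thesis by (simp add: U algebra_simps)
qed

lemma manifold_equations:
  fixes F :: "real^'n \<Rightarrow> real^'n" and u0 v vs :: "real \<Rightarrow> real^'n"
  assumes C: "Ck_on 3 UNIV F" and T: "0 < T"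
    and u0: "\<And>t. (u0 has_vector_derivative F (u0 t)) (at t)"
    and v: "\<And>\<tau>. \<tau> \<in> {0..T} \<Longrightarrow> (v has_vector_derivative D1 F (u0 \<tau>) (v \<tau>) + F (u0 \<tau>)) (at \<tau>)"
    and M: "CPC_center_manifold F u0 T v vs a1 a2 c"
  obtains h2 h2' h3 h3' where
    "\<And>\<tau>. (h2 has_vector_derivative h2' \<tau>) (at \<tau>)" "\<And>\<tau>. (h3 has_vector_derivative h3' \<tau>) (at \<tau>)"
    "h2 T = h2 0" "h3 T = h3 0" "integral {0..T} (\<lambda>\<tau>. vs \<tau> \<bullet> h2 \<tau>) = 0"
    "\<And>\<tau>. \<tau> \<in> {0..T} \<Longrightarrow> h2' \<tau> = D1 F (u0 \<tau>) (h2 \<tau>) + (D2 F (u0 \<tau>) (v \<tau>) (v \<tau>)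
        + 2 *\<^sub>R D1 F (u0 \<tau>) (v \<tau>) + 2 *\<^sub>R F (u0 \<tau>) - (2 * a1) *\<^sub>R F (u0 \<tau>))"
    "\<And>\<tau>. \<tau> \<in> {0..T} \<Longrightarrow> h3' \<tau> = D1 F (u0 \<tau>) (h3 \<tau>) + (3 *\<^sub>R h2' \<tau>
        - (6 * a1) *\<^sub>R (D1 F (u0 \<tau>) (v \<tau>) + F (u0 \<tau>)) - (6 * a2) *\<^sub>R F (u0 \<tau>) - (6 * c) *\<^sub>R v \<tau>
        + D3 F (u0 \<tau>) (v \<tau>) (v \<tau>) (v \<tau>) + 3 *\<^sub>R D2 F (u0 \<tau>) (h2 \<tau>) (v \<tau>))"
proof -
  from M obtain \<delta> H h2 h3 R S U P Q where \<delta>: "0 < \<delta>"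
    and H: "Ck_on 4 (UNIV \<times> {-\<delta><..<\<delta>}) H"
    and Hper: "\<And>\<tau> \<xi>. \<bar>\<xi>\<bar> < \<delta> \<Longrightarrow> H (\<tau> + T, \<xi>) = H (\<tau>, \<xi>)"
    and Hex: "\<And>\<tau>. (\<lambda>\<xi>. norm (H (\<tau>, \<xi>) - (\<xi>^2 / 2) *\<^sub>R h2 \<tau> - (\<xi>^3 / 6) *\<^sub>R h3 \<tau>)) \<in> O[at 0](\<lambda>\<xi>. \<xi>^4)"
    and int: "integral {0..T} (\<lambda>\<tau>. vs \<tau> \<bullet> h2 \<tau>) = 0"
    and R: "Ck_on 1 (UNIV \<times> {-\<delta><..<\<delta>}) R" and S: "Ck_on 1 (UNIV \<times> {-\<delta><..<\<delta>}) S"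
    and RS: "\<And>\<tau>. (\<lambda>\<xi>. R (\<tau>, \<xi>)) \<in> O[at 0](\<lambda>\<xi>. \<xi>^4)" "\<And>\<tau>. (\<lambda>\<xi>. S (\<tau>, \<xi>)) \<in> O[at 0](\<lambda>\<xi>. \<xi>^4)"
    and U: "U = (\<lambda>(\<tau>, \<xi>). u0 \<tau> + \<xi> *\<^sub>R v \<tau> + H (\<tau>, \<xi>))"
    and P: "P = (\<lambda>(\<tau>, \<xi>). 1 - \<xi> + a1 * \<xi>^2 + a2 * \<xi>^3 + R (\<tau>, \<xi>))"
    and Q: "Q = (\<lambda>(\<tau>, \<xi>). c * \<xi>^3 + S (\<tau>, \<xi>))"
    and inv: "\<forall>a b x y.
           (\<forall>t\<in>{a<..<b::real}. \<bar>y t\<bar> < \<delta> \<and>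
              (x has_real_derivative P (x t, y t)) (at t) \<and>
              (y has_real_derivative Q (x t, y t)) (at t)) \<longrightarrow>
           (\<forall>t\<in>{a<..<b}. ((\<lambda>t. U (x t, y t)) has_vector_derivative F (U (x t, y t))) (at t))"
    unfolding CPC_center_manifold_def
  proof (elim conjE exE, goal_cases)
    case (1 \<delta> H h2 h3 R S U P Q)
    note RS = spec[OF 1(11)]
    show ?case
      by (rule 1(1)[OF 1(3,4) 1(5)[rule_format] spec[OF 1(6)] 1(7,8,9) conjunct1[OF RS] conjunct2[OF RS] 1(12-15)])
  qed
  have ex: "expands (\<lambda>\<xi>. H (\<tau>, \<xi>)) 0 0 ((1/2) *\<^sub>R h2 \<tau>) ((1/6) *\<^sub>R h3 \<tau>)" for \<tau>
    by (rule expands_bigo) (use Hex[of \<tau>] in \<open>simp add: diff_diff_eq\<close>)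
  have near: "\<forall>\<^sub>F \<xi> in at 0. \<bar>\<xi>\<bar> < \<delta>" unfolding eventually_at using \<delta> by (intro exI[of _ \<delta>]) auto
  \<comment> \<open>Periodicity of \<open>h2\<close> and \<open>h3\<close> is inherited from that of
    \<open>H\<close> by uniqueness of coefficients.\<close>
  have "\<forall>\<^sub>F \<xi> in at 0. H (T, \<xi>) = H (0, \<xi>)" using near by eventually_elim (use Hper[of _ 0] in simp)
  from expands_unique[OF expands_cong[OF ex[of T] this] ex[of 0]]
  have per: "h2 T = h2 0" "h3 T = h3 0" by auto
  obtain h2' h3' where h2': "\<And>\<tau>. (h2 has_vector_derivative h2' \<tau>) (at \<tau>)" and h3': "\<And>\<tau>. (h3 has_vector_derivative h3' \<tau>) (at \<tau>)"
    and e1: "\<And>\<tau>. expands (\<lambda>\<xi>. partial1 H (\<tau>, \<xi>)) 0 0 ((1/2) *\<^sub>R h2' \<tau>) ((1/6) *\<^sub>R h3' \<tau>)"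
    and e2: "\<And>\<tau>. \<exists>b c d. expands (\<lambda>\<xi>. partial2 H (\<tau>, \<xi>)) 0 b c d"
    by (rule manifold_coefficients[OF \<delta> H ex]) blast
  have orders: "(1/2) *\<^sub>R h2' \<tau> - (D1 F (u0 \<tau>) (v \<tau>) + F (u0 \<tau>)) + a1 *\<^sub>R F (u0 \<tau>)
       = (1/2) *\<^sub>R D2 F (u0 \<tau>) (v \<tau>) (v \<tau>) + D1 F (u0 \<tau>) ((1/2) *\<^sub>R h2 \<tau>)"
    "(1/6) *\<^sub>R h3' \<tau> - (1/2) *\<^sub>R h2' \<tau> + a1 *\<^sub>R (D1 F (u0 \<tau>) (v \<tau>) + F (u0 \<tau>)) + a2 *\<^sub>R F (u0 \<tau>) + c *\<^sub>R v \<tau>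
       = (1/6) *\<^sub>R D3 F (u0 \<tau>) (v \<tau>) (v \<tau>) (v \<tau>) + D2 F (u0 \<tau>) ((1/2) *\<^sub>R h2 \<tau>) (v \<tau>) + D1 F (u0 \<tau>) ((1/6) *\<^sub>R h3 \<tau>)"
    if \<tau>: "\<tau> \<in> {0..T}" for \<tau>
  proof -
    have "expands (\<lambda>\<xi>. R (\<tau>, \<xi>)) 0 0 0 0" "expands (\<lambda>\<xi>. S (\<tau>, \<xi>)) 0 0 0 0"
      by (rule expands_bigo, use RS[of \<tau>] in simp)+
    then have eP: "expands (\<lambda>\<xi>. P (\<tau>, \<xi>)) 1 (-1) a1 a2" and eQ: "expands (\<lambda>\<xi>. Q (\<tau>, \<xi>)) 0 0 0 c"
      using expands_add[OF expands_poly[of 1 "-1" a1 a2]] expands_add[OF expands_poly[of 0 0 0 c]]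
      by (fastforce simp: P Q mult.commute)+
    obtain b1 b2 b3 where e2': "expands (\<lambda>\<xi>. partial2 H (\<tau>, \<xi>)) 0 b1 b2 b3" using e2 by blast
    have H': "Ck_on (Suc 3) (UNIV \<times> {-\<delta><..<\<delta>}) H" using H by (simp add: eval_nat_numeral del: Ck_on.simps)
    have eq: "\<forall>\<^sub>F \<xi> in at 0. P (\<tau>, \<xi>) *\<^sub>R (F (u0 \<tau>) + \<xi> *\<^sub>R (D1 F (u0 \<tau>) (v \<tau>) + F (u0 \<tau>)) + partial1 H (\<tau>, \<xi>))
        + Q (\<tau>, \<xi>) *\<^sub>R (v \<tau> + partial2 H (\<tau>, \<xi>)) = F (u0 \<tau> + \<xi> *\<^sub>R v \<tau> + H (\<tau>, \<xi>))"
      using near by eventually_elim (rule manifold_homological_equation[OF H' R S P Q U inv u0 v[OF \<tau>]])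
    show "(1/2) *\<^sub>R h2' \<tau> - (D1 F (u0 \<tau>) (v \<tau>) + F (u0 \<tau>)) + a1 *\<^sub>R F (u0 \<tau>)
       = (1/2) *\<^sub>R D2 F (u0 \<tau>) (v \<tau>) (v \<tau>) + D1 F (u0 \<tau>) ((1/2) *\<^sub>R h2 \<tau>)"
      "(1/6) *\<^sub>R h3' \<tau> - (1/2) *\<^sub>R h2' \<tau> + a1 *\<^sub>R (D1 F (u0 \<tau>) (v \<tau>) + F (u0 \<tau>)) + a2 *\<^sub>R F (u0 \<tau>) + c *\<^sub>R v \<tau>
       = (1/6) *\<^sub>R D3 F (u0 \<tau>) (v \<tau>) (v \<tau>) (v \<tau>) + D2 F (u0 \<tau>) ((1/2) *\<^sub>R h2 \<tau>) (v \<tau>) + D1 F (u0 \<tau>) ((1/6) *\<^sub>R h3 \<tau>)"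
      by (rule homological_equation_orders[OF C eP eQ e1 e2' ex eq])+
  qed
  have C1: "Ck_on (Suc 2) UNIV F" and C2: "Ck_on 2 UNIV F"
    using C Ck_on_le[OF C, of 2] by (simp_all add: eval_nat_numeral del: Ck_on.simps)
  \<comment> \<open>Linearity takes the factors 1/2 and 1/6 out of the derivatives; multiplied by 2
    and 6, the two orders are the equations below.\<close>
  note D1_cmul = linear_cmul[OF D1_linear[OF C1]] and D2_cmul = linear_cmul[OF D2_linear_left[OF C2]]
  show ?thesis
  proof (rule that[OF h2' h3' per int])
    fix \<tau> assume \<tau>: "\<tau> \<in> {0..T}"
    show "h2' \<tau> = D1 F (u0 \<tau>) (h2 \<tau>) + (D2 F (u0 \<tau>) (v \<tau>) (v \<tau>)
        + 2 *\<^sub>R D1 F (u0 \<tau>) (v \<tau>) + 2 *\<^sub>R F (u0 \<tau>) - (2 * a1) *\<^sub>R F (u0 \<tau>))"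
      (is "_ = ?r")
    proof (subst vec_eq_iff, rule allI)
      fix i
      show "h2' \<tau> $ i = ?r $ i"
        using arg_cong[OF orders(1)[OF \<tau>], of "\<lambda>x. x $ i"] by (simp add: D1_cmul algebra_simps)
    qed
    show "h3' \<tau> = D1 F (u0 \<tau>) (h3 \<tau>) + (3 *\<^sub>R h2' \<tau>
        - (6 * a1) *\<^sub>R (D1 F (u0 \<tau>) (v \<tau>) + F (u0 \<tau>)) - (6 * a2) *\<^sub>R F (u0 \<tau>) - (6 * c) *\<^sub>R v \<tau>
        + D3 F (u0 \<tau>) (v \<tau>) (v \<tau>) (v \<tau>) + 3 *\<^sub>R D2 F (u0 \<tau>) (h2 \<tau>) (v \<tau>))"
      (is "_ = ?r")
    proof (subst vec_eq_iff, rule allI)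
      fix i
      show "h3' \<tau> $ i = ?r $ i"
        using arg_cong[OF orders(2)[OF \<tau>], of "\<lambda>x. x $ i"] by (simp add: D1_cmul D2_cmul algebra_simps)
    qed
  qed
qed

section \<open>Periodic solutions of the variational equation\<close>

lemma Amat_mult:
  assumes "Ck_on (Suc k) UNIV F"
  shows "Amat F u0 \<tau> *v w = D1 F (u0 \<tau>) w"
proof -
  have "F differentiable (at (u0 \<tau>))" using assms by simp
  then have "(F has_derivative (\<lambda>h. Amat F u0 \<tau> *v h)) (at (u0 \<tau>))"
    unfolding Amat_def using jacobian_works by blast
  from fun_cong[OF has_derivative_unique[OF this D1_has_derivative[OF assms]], of w] show ?thesis .
qed

text \<open>Compactness of the time interval times the unit sphere bounds the derivative on unit
  vectors, and homogeneity does the rest. This is the constant for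
  \<open>linear_ode_zero\<close>.\<close>

lemma D1_bounded_along:
  fixes F :: "'a::euclidean_space \<Rightarrow> 'b::real_normed_vector" and u0 :: "real \<Rightarrow> 'a"
  assumes C: "Ck_on (Suc k) UNIV F" and u0: "continuous_on {0..T} u0"
  obtains K where "\<And>\<tau> w. \<tau> \<in> {0..T} \<Longrightarrow> norm (D1 F (u0 \<tau>) w) \<le> K * norm w"
proof -
  let ?S = "{0..T} \<times> sphere (0::'a) 1"
  have "continuous_on ?S (\<lambda>p. D1 F (u0 (fst p)) (snd p))"
  proof (rule continuous_on_D1[OF C])
    show "continuous_on ?S (\<lambda>p. u0 (fst p))"
      by (rule continuous_on_compose2[OF u0]) (auto intro!: continuous_intros)
  qed (intro continuous_intros)
  then have "bounded ((\<lambda>p. D1 F (u0 (fst p)) (snd p)) ` ?S)"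
    by (intro compact_imp_bounded compact_continuous_image compact_Times) auto
  then obtain K where K: "\<And>p. p \<in> ?S \<Longrightarrow> norm (D1 F (u0 (fst p)) (snd p)) \<le> K"
    unfolding bounded_iff by blast
  note lin = D1_linear[OF C]
  show ?thesis
  proof (rule that)
    fix \<tau> w assume \<tau>: "\<tau> \<in> {0..T}"
    show "norm (D1 F (u0 \<tau>) w) \<le> K * norm w"
    proof (cases "w = 0")
      case True
      then show ?thesis by (simp add: linear_0[OF lin])
    next
      case False
      then have "norm (D1 F (u0 \<tau>) ((1 / norm w) *\<^sub>R w)) \<le> K" using K[of "(\<tau>, (1 / norm w) *\<^sub>R w)"] \<tau> by simp
      then show ?thesis using False by (simp add: linear_cmul[OF lin] field_simps)
    qed
  qed
qed

text \<open>Periodic solutions start at fixed vectors of \<open>Y T\<close>. By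
  \<open>jordan_chain_kernel\<close> the initial values of \<open>d\<close> and of the velocity lie
  on one line, and uniqueness for the linear equation carries their proportionality over the whole
  period.\<close>

lemma periodic_solution_multiple_of_flow:
  fixes F :: "real^'n \<Rightarrow> real^'n" and u0 d :: "real \<Rightarrow> real^'n"
  assumes C: "Ck_on 3 UNIV F" and cycle: "limit_cycle F u0 T"
    and Y: "fundamental_matrix F u0 T Y" and mult: "CPC_multipliers (Y T)"
    and d: "\<And>\<tau>. \<tau> \<in> {0..T} \<Longrightarrow> (d has_vector_derivative Amat F u0 \<tau> *v d \<tau>) (at \<tau> within {0..T})"
    and per: "d T = d 0"
  obtains \<beta> where "\<And>\<tau>. \<tau> \<in> {0..T} \<Longrightarrow> d \<tau> = \<beta> *\<^sub>R F (u0 \<tau>)"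
proof -
  have C1: "Ck_on (Suc 2) UNIV F" using C by (simp add: eval_nat_numeral del: Ck_on.simps)
  note A = Amat_mult[OF C1]
  have T: "0 < T" and u0: "\<And>t. (u0 has_vector_derivative F (u0 t)) (at t)"
    and u0per: "\<And>t. u0 (t + T) = u0 t" and nonconst: "\<exists>s t. u0 s \<noteq> u0 t"
    using cycle by (auto simp: limit_cycle_def)
  have u0c: "continuous_on S u0" for S
    using has_vector_derivative_continuous[OF u0] by (intro continuous_at_imp_continuous_on) auto
  obtain K where K: "\<And>\<tau> w. \<tau> \<in> {0..T} \<Longrightarrow> norm (Amat F u0 \<tau> *v w) \<le> K * norm w"
    using D1_bounded_along[OF C1 u0c[of "{0..T}"]] A by metis
  have unique: "p \<tau> = q \<tau>"
    if p: "\<And>\<tau>. \<tau> \<in> {0..T} \<Longrightarrow> (p has_vector_derivative Amat F u0 \<tau> *v p \<tau>) (at \<tau> within {0..T})"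
      and q: "\<And>\<tau>. \<tau> \<in> {0..T} \<Longrightarrow> (q has_vector_derivative Amat F u0 \<tau> *v q \<tau>) (at \<tau> within {0..T})"
      and "p 0 = q 0" and \<tau>: "\<tau> \<in> {0..T}" for p q \<tau>
  proof -
    have "(\<lambda>t. p t - q t) \<tau> = 0"
    proof (rule linear_ode_zero[where A="\<lambda>t. (*v) (Amat F u0 t)", OF K _ _ \<tau>])
      fix t assume t: "t \<in> {0..T}"
      show "((\<lambda>t. p t - q t) has_vector_derivative Amat F u0 t *v (p t - q t)) (at t within {0..T})"
        using has_vector_derivative_diff[OF p[OF t] q[OF t]] by (simp add: matrix_vector_mult_diff_distrib)
    qed (use \<open>p 0 = q 0\<close> in auto)
    then show ?thesis by simp
  qed
  have Ysol: "((\<lambda>\<tau>. Y \<tau> *v z) has_vector_derivative Amat F u0 \<tau> *v (Y \<tau> *v z)) (at \<tau> within {0..T})"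
    if "\<tau> \<in> {0..T}" for \<tau> z
  proof -
    have "bounded_linear (\<lambda>M :: real^'n^'n. M *v z)"
      by (intro linear_conv_bounded_linear[THEN iffD1] linearI)
        (simp_all add: matrix_vector_mult_add_rdistrib scaleR_matrix_vector_assoc)
    then have "((\<lambda>\<tau>. Y \<tau> *v z) has_vector_derivative (Amat F u0 \<tau> ** Y \<tau>) *v z) (at \<tau> within {0..T})"
      using Y that by (auto simp: fundamental_matrix_def intro: bounded_linear.has_vector_derivative)
    then show ?thesis by (simp add: matrix_vector_mul_assoc)
  qed
  have Y0: "Y 0 *v z = z" for z using Y by (simp add: fundamental_matrix_def)
  have flow: "((\<lambda>\<tau>. F (u0 \<tau>)) has_vector_derivative Amat F u0 \<tau> *v F (u0 \<tau>)) (at \<tau> within {0..T})" for \<tau>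
    unfolding A by (rule D1_has_vector_derivative[OF C1 has_vector_derivative_at_within[OF u0]])
  have fix_d: "Y T *v d 0 = d 0"
    using unique[OF Ysol d, of "d 0" T] T Y0 per by auto
  have fix_F: "Y T *v F (u0 0) = F (u0 0)"
    using unique[OF Ysol flow, of "F (u0 0)" T] T Y0 u0per[of 0] by auto
  \<comment> \<open>If the velocity vanished at time 0, linear uniqueness would make it vanish on a
    whole period, and by periodicity \<open>u0\<close> would be constant.\<close>
  have F0: "F (u0 0) \<noteq> 0"
  proof
    assume F0: "F (u0 0) = 0"
    have "F (u0 \<tau>) = 0" if "\<tau> \<in> {0..T}" for \<tau>
      using unique[OF flow, of "\<lambda>_. 0" \<tau>] F0 that by simp
    then have "(u0 has_vector_derivative 0) (at \<tau> within {0..T})" if "\<tau> \<in> {0..T}" for \<tau>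
      using has_vector_derivative_at_within[OF u0, of \<tau> "{0..T}"] that by simp
    then obtain z where z: "\<And>\<tau>. \<tau> \<in> {0..T} \<Longrightarrow> u0 \<tau> = z"
      using has_vector_derivative_zero_constant[of "{0..T}" u0] by auto
    have "u0 t = z" for t
    proof -
      have shift: "u0 (s + of_int k * T) = u0 s" for s and k :: int
      proof (induction k rule: int_induct[of _ 0])
        case (step1 i)
        then show ?case using u0per[of "s + of_int i * T"] by (simp add: algebra_simps)
      next
        case (step2 i)
        then show ?case using u0per[of "s + of_int (i - 1) * T"] by (simp add: algebra_simps)
      qed simp
      have "of_int \<lfloor>t / T\<rfloor> * T \<le> t" "t \<le> (of_int \<lfloor>t / T\<rfloor> + 1) * T"
        using T of_int_floor_le[of "t / T"] real_of_int_floor_add_one_ge[of "t / T"]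
        by (simp_all only: pos_le_divide_eq pos_divide_le_eq)
      then have "t + of_int (- \<lfloor>t / T\<rfloor>) * T \<in> {0..T}" by (simp add: algebra_simps)
      from z[OF this] shift[of t "- \<lfloor>t / T\<rfloor>"] show ?thesis by simp
    qed
    with nonconst show False by metis
  qed
  obtain q1 q2 where q: "q1 \<noteq> 0" "Y T *v q1 = q1" "Y T *v q2 = q2 + q1" and ord: "order 1 (charpoly (Y T)) = 2"
    using mult by (auto simp: CPC_multipliers_def)
  obtain r s where rs: "F (u0 0) = r *\<^sub>R q1" "d 0 = s *\<^sub>R q1"
    using jordan_chain_kernel[OF ord q fix_F] jordan_chain_kernel[OF ord q fix_d] by (auto simp: span_singleton)
  \<comment> \<open>Here \<open>r\<close> is nonzero because \<open>F (u0 0)\<close> is.\<close>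
  then have \<beta>: "d 0 = (s / r) *\<^sub>R F (u0 0)" using F0 by auto
  show ?thesis
  proof (rule that)
    fix \<tau> assume \<tau>: "\<tau> \<in> {0..T}"
    show "d \<tau> = (s / r) *\<^sub>R F (u0 \<tau>)"
    proof (rule unique[where p=d and q="\<lambda>\<tau>. (s / r) *\<^sub>R F (u0 \<tau>)", OF d _ \<beta> \<tau>])
      fix t
      show "((\<lambda>\<tau>. (s / r) *\<^sub>R F (u0 \<tau>)) has_vector_derivative Amat F u0 t *v ((s / r) *\<^sub>R F (u0 t))) (at t within {0..T})"
        using has_vector_derivative_scaleR[OF DERIV_const flow[of t]] by (simp add: matrix_vector_mult_scaleR)
    qed
  qed
qed

section \<open>The boundary value problem for \<open>h2\<close> and the formula for
  \<open>c\<close>\<close>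

theorem mainTheorem1:
  fixes F :: "real^'n \<Rightarrow> real^'n"
    and u0 v \<phi>s vs :: "real \<Rightarrow> real^'n"
    and Y :: "real \<Rightarrow> real^'n^'n"
    and T a1 a2 c :: real
  assumes "Ck_on 3 UNIV F"
    and "limit_cycle F u0 T"
    and "fundamental_matrix F u0 T Y"
    and "CPC_multipliers (Y T)"
    and "v_bvp F u0 T v"
    and "phi_star_bvp F u0 T v \<phi>s"
    and "v_star_bvp F u0 T v \<phi>s vs"
    and "CPC_center_manifold F u0 T v vs a1 a2 c"
  shows "(\<forall>\<alpha>1::real. \<exists>h2. h2_bvp F u0 T v vs \<alpha>1 h2 \<and>
              (\<forall>g. h2_bvp F u0 T v vs \<alpha>1 g \<longrightarrow> (\<forall>\<tau>\<in>{0..T}. g \<tau> = h2 \<tau>)) \<and>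
              c = c_formula F u0 T v \<phi>s \<alpha>1 h2) \<and>
         (\<forall>\<alpha>1 \<alpha>1' h2 h2'.
              h2_bvp F u0 T v vs \<alpha>1 h2 \<and> h2_bvp F u0 T v vs \<alpha>1' h2' \<longrightarrow>
              c_formula F u0 T v \<phi>s \<alpha>1 h2 = c_formula F u0 T v \<phi>s \<alpha>1' h2')"
proof -
  have C1: "Ck_on (Suc 2) UNIV F" and C2: "Ck_on 2 UNIV F"
    using assms(1) Ck_on_le[OF assms(1), of 2] by (simp_all add: eval_nat_numeral del: Ck_on.simps)
  note A = Amat_mult[OF C1]
  have T: "0 < T" "0 \<le> T" and u0: "\<And>t. (u0 has_vector_derivative F (u0 t)) (at t)"
    and u0per: "\<And>t. u0 (t + T) = u0 t"
    using assms(2) by (auto simp: limit_cycle_def)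
  have v: "\<And>\<tau>. \<tau> \<in> {0..T} \<Longrightarrow>
      (v has_vector_derivative Amat F u0 \<tau> *v v \<tau> + F (u0 \<tau>)) (at \<tau> within {0..T})" and vT: "v T = v 0"
    using assms(5) by (auto simp: v_bvp_def)
  have \<phi>: "\<And>\<tau>. \<tau> \<in> {0..T} \<Longrightarrow>
      (\<phi>s has_vector_derivative - (transpose (Amat F u0 \<tau>) *v \<phi>s \<tau>)) (at \<tau> within {0..T})"
    and \<phi>T: "\<phi>s T = \<phi>s 0" and \<phi>v: "integral {0..T} (\<lambda>\<tau>. \<phi>s \<tau> \<bullet> v \<tau>) = 1"
    using assms(6) by (auto simp: phi_star_bvp_def)
  have vs: "\<And>\<tau>. \<tau> \<in> {0..T} \<Longrightarrow>
      (vs has_vector_derivative - (transpose (Amat F u0 \<tau>) *v vs \<tau>) - \<phi>s \<tau>) (at \<tau> within {0..T})"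
    and vsT: "vs T = vs 0" and vsv: "integral {0..T} (\<lambda>\<tau>. vs \<tau> \<bullet> v \<tau>) = 0"
    using assms(7) by (auto simp: v_star_bvp_def)
  have vper: "\<And>\<tau>. v (\<tau> + T) = v \<tau>"
    using assms(8) by (simp add: CPC_center_manifold_def)
  \<comment> \<open>The derivative prescribed for \<open>v\<close> takes equal values at 0 and
    \<open>T\<close>, as the passage to two-sided derivatives requires.\<close>
  have "Amat F u0 T *v v T + F (u0 T) = Amat F u0 0 *v v 0 + F (u0 0)"
    using u0per[of 0] vT by (simp add: A)
  then have v_at: "(v has_vector_derivative D1 F (u0 \<tau>) (v \<tau>) + F (u0 \<tau>)) (at \<tau>)" if "\<tau> \<in> {0..T}" for \<tau>
    using periodic_has_vector_derivative[OF T(1) vper v _ that] by (simp add: A)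
  obtain h h' k k' where h: "\<And>\<tau>. (h has_vector_derivative h' \<tau>) (at \<tau>)" and k: "\<And>\<tau>. (k has_vector_derivative k' \<tau>) (at \<tau>)"
    and hT: "h T = h 0" and kT: "k T = k 0" and vsh: "integral {0..T} (\<lambda>\<tau>. vs \<tau> \<bullet> h \<tau>) = 0"
    and h': "\<And>\<tau>. \<tau> \<in> {0..T} \<Longrightarrow> h' \<tau> = D1 F (u0 \<tau>) (h \<tau>) + (D2 F (u0 \<tau>) (v \<tau>) (v \<tau>)
        + 2 *\<^sub>R D1 F (u0 \<tau>) (v \<tau>) + 2 *\<^sub>R F (u0 \<tau>) - (2 * a1) *\<^sub>R F (u0 \<tau>))"
    and k': "\<And>\<tau>. \<tau> \<in> {0..T} \<Longrightarrow> k' \<tau> = D1 F (u0 \<tau>) (k \<tau>) + (3 *\<^sub>R h' \<tau>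
        - (6 * a1) *\<^sub>R (D1 F (u0 \<tau>) (v \<tau>) + F (u0 \<tau>)) - (6 * a2) *\<^sub>R F (u0 \<tau>) - (6 * c) *\<^sub>R v \<tau>
        + D3 F (u0 \<tau>) (v \<tau>) (v \<tau>) (v \<tau>) + 3 *\<^sub>R D2 F (u0 \<tau>) (h \<tau>) (v \<tau>))"
  proof (rule manifold_equations[OF assms(1) T(1) u0 v_at assms(8)], goal_cases)
    case 2
    show ?case using 2(2-) by (rule 2(1))
  qed
  have cont: "continuous_on {0..T} p"
    if "\<And>\<tau>. \<tau> \<in> {0..T} \<Longrightarrow> (p has_vector_derivative p' \<tau>) (at \<tau> within {0..T})" for p p' :: "real \<Rightarrow> real^'n"
    using has_vector_derivative_continuous[OF that] by (simp add: continuous_on_eq_continuous_within)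
  have I: "((\<lambda>\<tau>. p \<tau> \<bullet> q \<tau>) has_integral integral {0..T} (\<lambda>\<tau>. p \<tau> \<bullet> q \<tau>)) {0..T}"
    if "continuous_on {0..T} p" "continuous_on {0..T} q" for p q :: "real \<Rightarrow> real^'n"
    by (intro integrable_integral integrable_continuous_interval continuous_on_inner that)
  have h_within: "(h has_vector_derivative h' \<tau>) (at \<tau> within {0..T})"
    and k_within: "(k has_vector_derivative k' \<tau>) (at \<tau> within {0..T})" for \<tau>
    using h k has_vector_derivative_at_within by blast+
  have \<phi>0: "(\<phi>s has_vector_derivative - (transpose (Amat F u0 \<tau>) *v \<phi>s \<tau>) - 0) (at \<tau> within {0..T})"
    if "\<tau> \<in> {0..T}" for \<tau> using \<phi>[OF that] by simp
  \<comment> \<open>The periodic equation for \<open>v\<close> has inhomogeneity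
    \<open>F (u0 \<tau>)\<close>; its solvability forces the pairing with \<open>\<phi>s\<close> to
    be 0.\<close>
  have I\<phi>F: "((\<lambda>\<tau>. \<phi>s \<tau> \<bullet> F (u0 \<tau>)) has_integral 0) {0..T}"
    using adjoint_has_integral[OF T(2) \<phi>0 v \<phi>T vT] by simp
  have I\<phi>v: "((\<lambda>\<tau>. \<phi>s \<tau> \<bullet> v \<tau>) has_integral 1) {0..T}"
    using I[OF cont[OF \<phi>] cont[OF v]] by (simp add: \<phi>v)
  have Ivsv: "((\<lambda>\<tau>. vs \<tau> \<bullet> v \<tau>) has_integral 0) {0..T}"
    using I[OF cont[OF vs] cont[OF v]] by (simp add: vsv)
  have Ivsh: "((\<lambda>\<tau>. vs \<tau> \<bullet> h \<tau>) has_integral 0) {0..T}"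
    using I[OF cont[OF vs] cont[OF h_within]] by (simp add: vsh)
  \<comment> \<open>Pairing the equation for \<open>v\<close> with \<open>vs\<close> equates the
    integrals of \<open>vs \<tau> \<bullet> F (u0 \<tau>)\<close> and
    \<open>\<phi>s \<tau> \<bullet> v \<tau>\<close>, and the latter is normalized to 1.\<close>
  have IvsF: "((\<lambda>\<tau>. vs \<tau> \<bullet> F (u0 \<tau>)) has_integral 1) {0..T}"
    using has_integral_add[OF adjoint_has_integral[OF T(2) vs v vsT vT] I\<phi>v] by simp
  let ?B = "\<lambda>\<tau>. D2 F (u0 \<tau>) (v \<tau>) (v \<tau>)" and ?Av = "\<lambda>\<tau>. D1 F (u0 \<tau>) (v \<tau>)" and ?F = "\<lambda>\<tau>. F (u0 \<tau>)"
  let ?G2 = "\<lambda>\<tau>. ?B \<tau> + 2 *\<^sub>R ?Av \<tau> + 2 *\<^sub>R ?F \<tau> - (2 * a1) *\<^sub>R ?F \<tau>"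
  let ?G3 = "\<lambda>\<tau>. 3 *\<^sub>R h' \<tau> - (6 * a1) *\<^sub>R (?Av \<tau> + ?F \<tau>) - (6 * a2) *\<^sub>R ?F \<tau> - (6 * c) *\<^sub>R v \<tau>
        + D3 F (u0 \<tau>) (v \<tau>) (v \<tau>) (v \<tau>) + 3 *\<^sub>R D2 F (u0 \<tau>) (h \<tau>) (v \<tau>)"
  have h_ode: "(h has_vector_derivative Amat F u0 \<tau> *v h \<tau> + ?G2 \<tau>) (at \<tau> within {0..T})" if "\<tau> \<in> {0..T}" for \<tau>
    using h_within[of \<tau>] h'[OF that] by (simp add: A)
  have k_ode: "(k has_vector_derivative Amat F u0 \<tau> *v k \<tau> + ?G3 \<tau>) (at \<tau> within {0..T})" if "\<tau> \<in> {0..T}" for \<tau>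
    using k_within[of \<tau>] k'[OF that] by (simp add: A)
  have I2: "((\<lambda>\<tau>. \<phi>s \<tau> \<bullet> ?G2 \<tau>) has_integral 0) {0..T}"
    using adjoint_has_integral[OF T(2) \<phi>0 h_ode \<phi>T hT] by simp
  have I3: "((\<lambda>\<tau>. \<phi>s \<tau> \<bullet> ?G3 \<tau>) has_integral 0) {0..T}"
    using adjoint_has_integral[OF T(2) \<phi>0 k_ode \<phi>T kT] by simp
  note D1_lin = linear_add[OF D1_linear[OF C1]] linear_diff[OF D1_linear[OF C1]] linear_cmul[OF D1_linear[OF C1]]
  note D2_lin = linear_diff[OF D2_linear_left[OF C2]] linear_cmul[OF D2_linear_left[OF C2]]
  \<comment> \<open>As \<open>v\<close> is mapped to \<open>F (u0 \<tau>)\<close> by the linear operator of the problem and is orthogonal to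
     \<open>vs\<close>, changing \<open>\<alpha>1\<close> only shifts the solution by a multiple of \<open>v\<close>.\<close>
  define g where "g \<alpha> \<tau> = h \<tau> - (2 * (\<alpha> - a1)) *\<^sub>R v \<tau>" for \<alpha> \<tau>
  have bvp: "h2_bvp F u0 T v vs \<alpha> (g \<alpha>)" for \<alpha>
    unfolding h2_bvp_def
  proof (intro conjI ballI)
    fix \<tau> assume \<tau>: "\<tau> \<in> {0..T}"
    have "(g \<alpha> has_vector_derivative (Amat F u0 \<tau> *v h \<tau> + ?G2 \<tau>)
        - (2 * (\<alpha> - a1)) *\<^sub>R (Amat F u0 \<tau> *v v \<tau> + F (u0 \<tau>))) (at \<tau> within {0..T})"
      unfolding g_def
      by (intro has_vector_derivative_diff h_ode[OF \<tau>] bounded_linear.has_vector_derivative[OF bounded_linear_scaleR_right] v[OF \<tau>])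
    moreover have "(Amat F u0 \<tau> *v h \<tau> + ?G2 \<tau>) - (2 * (\<alpha> - a1)) *\<^sub>R (Amat F u0 \<tau> *v v \<tau> + F (u0 \<tau>))
      = Amat F u0 \<tau> *v g \<alpha> \<tau> + Bform F u0 \<tau> (v \<tau>) (v \<tau>) + 2 *\<^sub>R (Amat F u0 \<tau> *v v \<tau>)
          + 2 *\<^sub>R F (u0 \<tau>) - (2 * \<alpha>) *\<^sub>R F (u0 \<tau>)"
      by (simp add: g_def A D1_lin Bform_def algebra_simps)
    ultimately show "(g \<alpha> has_vector_derivative Amat F u0 \<tau> *v g \<alpha> \<tau> + Bform F u0 \<tau> (v \<tau>) (v \<tau>)
        + 2 *\<^sub>R (Amat F u0 \<tau> *v v \<tau>) + 2 *\<^sub>R F (u0 \<tau>) - (2 * \<alpha>) *\<^sub>R F (u0 \<tau>)) (at \<tau> within {0..T})"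
      by (simp only:)
  next
    show "g \<alpha> T - g \<alpha> 0 = 0" by (simp add: g_def hT vT)
    have "((\<lambda>\<tau>. vs \<tau> \<bullet> h \<tau> - (2 * (\<alpha> - a1)) * (vs \<tau> \<bullet> v \<tau>)) has_integral 0 - (2 * (\<alpha> - a1)) * 0) {0..T}"
      by (intro has_integral_diff has_integral_mult_right Ivsh Ivsv)
    then show "integral {0..T} (\<lambda>\<tau>. vs \<tau> \<bullet> g \<alpha> \<tau>) = 0"
      by (intro integral_unique) (simp add: g_def inner_diff_right)
  qed
  have unique: "p \<tau> = q \<tau>" if p: "h2_bvp F u0 T v vs \<alpha> p" and q: "h2_bvp F u0 T v vs \<alpha> q" and \<tau>: "\<tau> \<in> {0..T}" for \<alpha> p q \<tau>
  proof -
    note p' = p[unfolded h2_bvp_def, THEN conjunct1, rule_format]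
    note q' = q[unfolded h2_bvp_def, THEN conjunct1, rule_format]
    have d_ode: "((\<lambda>\<tau>. p \<tau> - q \<tau>) has_vector_derivative Amat F u0 t *v (p t - q t)) (at t within {0..T})" if "t \<in> {0..T}" for t
      using has_vector_derivative_diff[OF p'[OF that] q'[OF that]] by (simp add: matrix_vector_mult_diff_distrib)
    have d_per: "p T - q T = p 0 - q 0" using p q by (simp add: h2_bvp_def)
    obtain \<beta> where \<beta>: "\<And>\<tau>. \<tau> \<in> {0..T} \<Longrightarrow> p \<tau> - q \<tau> = \<beta> *\<^sub>R F (u0 \<tau>)"
    proof (rule periodic_solution_multiple_of_flow[OF assms(1-4) d_ode d_per], goal_cases)
      case 2
      show ?case using 2(2) by (rule 2(1))
    qed
    have Ip: "((\<lambda>\<tau>. vs \<tau> \<bullet> p \<tau>) has_integral 0) {0..T}" and Iq: "((\<lambda>\<tau>. vs \<tau> \<bullet> q \<tau>) has_integral 0) {0..T}"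
      using I[OF cont[OF vs] cont[OF p']] I[OF cont[OF vs] cont[OF q']] p q by (simp_all add: h2_bvp_def)
    \<comment> \<open>Against \<open>vs\<close> both \<open>p\<close> and \<open>q\<close> integrate
      to 0, whereas their difference integrates to \<beta>; hence \<beta> is 0.\<close>
    have "((\<lambda>\<tau>. \<beta> * (vs \<tau> \<bullet> F (u0 \<tau>))) has_integral \<beta> * 1) {0..T}"
      by (rule has_integral_mult_right[OF IvsF])
    moreover have "((\<lambda>\<tau>. \<beta> * (vs \<tau> \<bullet> F (u0 \<tau>))) has_integral 0 - 0) {0..T}"
    proof (rule has_integral_eq[OF _ has_integral_diff[OF Ip Iq]])
      fix t assume "t \<in> {0..T}"
      from arg_cong[OF \<beta>[OF this], of "(\<bullet>) (vs t)"]
      show "vs t \<bullet> p t - vs t \<bullet> q t = \<beta> * (vs t \<bullet> F (u0 t))" by (simp add: inner_diff_right)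
    qed
    ultimately have "\<beta> * 1 = 0 - 0" by (rule has_integral_unique)
    then show ?thesis using \<beta>[OF \<tau>] by simp
  qed
  have formula: "c_formula F u0 T v \<phi>s \<alpha> (g \<alpha>) = c" for \<alpha>
  proof -
    let ?J = "\<lambda>\<tau>. \<phi>s \<tau> \<bullet>
       (- (6 * \<alpha>) *\<^sub>R (Amat F u0 \<tau> *v v \<tau>) + 3 *\<^sub>R (Amat F u0 \<tau> *v g \<alpha> \<tau>)
        + 3 *\<^sub>R Bform F u0 \<tau> (v \<tau>) (v \<tau>) + 6 *\<^sub>R (Amat F u0 \<tau> *v v \<tau>)
        + 3 *\<^sub>R Bform F u0 \<tau> (g \<alpha> \<tau>) (v \<tau>) + Cform F u0 \<tau> (v \<tau>) (v \<tau>) (v \<tau>))"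
    \<comment> \<open>The multiple of \<open>?G2\<close> subtracted below accounts for the terms in
      \<open>?B\<close> and \<open>?Av\<close> that the shift from \<open>h\<close> to
      \<open>g \<alpha>\<close> produces. The number \<open>?m\<close> is then determined by
      cancelling every multiple of \<open>F (u0 \<tau>)\<close>, those from \<open>?G3\<close> with
      \<open>h'\<close> inserted as well as those from \<open>?G2\<close>.\<close>
    let ?m = "6 * a2 + 12 * a1 - 6 + 6 * (\<alpha> - a1) * (2 - 2 * a1)"
    have "\<phi>s \<tau> \<bullet> ?G3 \<tau> + (6 * c) * (\<phi>s \<tau> \<bullet> v \<tau>) + ?m * (\<phi>s \<tau> \<bullet> ?F \<tau>) - (6 * (\<alpha> - a1)) * (\<phi>s \<tau> \<bullet> ?G2 \<tau>) = ?J \<tau>"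
      if "\<tau> \<in> {0..T}" for \<tau>
      unfolding h'[OF that] g_def A Bform_def Cform_def D1_lin D2_lin inner_add_right inner_diff_right inner_scaleR_right
      by (simp add: algebra_simps)
    from has_integral_eq[OF this has_integral_diff[OF has_integral_add[OF has_integral_add[OF I3
          has_integral_mult_right[OF I\<phi>v]] has_integral_mult_right[OF I\<phi>F]] has_integral_mult_right[OF I2]]]
    have "(?J has_integral 0 + (6 * c) * 1 + ?m * 0 - (6 * (\<alpha> - a1)) * 0) {0..T}" .
    then show ?thesis unfolding c_formula_def by (simp add: integral_unique)
  qed
  have formula': "c_formula F u0 T v \<phi>s \<alpha> p = c" if "h2_bvp F u0 T v vs \<alpha> p" for \<alpha> p
  proof -
    have "c_formula F u0 T v \<phi>s \<alpha> p = c_formula F u0 T v \<phi>s \<alpha> (g \<alpha>)"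
      unfolding c_formula_def using unique[OF that bvp] by (intro arg_cong[where f="(*) (1/6)"] integral_cong) simp
    then show ?thesis by (simp add: formula)
  qed
  show ?thesis using bvp unique formula' by metis
qed

end
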